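(* If $\mathfrak{a}$ is a finite-dimensional Lie algebra over a field of prime characteristic, then the injective hull of every locally finite $\mathfrak{a}$-module is locally finite.
   Context: An $\mathfrak{a}$-module is the same as a unital $U(\mathfrak{a})$-module, where $U(\mathfrak{a})$ is the universal enveloping algebra; injective hulls are taken in the category of all $U(\mathfrak{a})$-modules. A module is locally finite if every finitely generated (equivalently, every cyclic) submodule is finite-dimensional over the ground field. *)

theory Defs
  imports "HOL-Computational_Algebra.Primes" "HOL-Algebra.Multiplicative_Group"
    "Jordan_Normal_Form.Missing_VectorSpace"
begin

section \<open>Lie algebras and their modules\<close>

text \<open>
  Vector spaces are those of \<^locale>\<open>vectorspace\<close>; the ring fields \<open>mult\<close> and \<open>one\<close> that
  their record type inherits are never used.
\<close>

record ('k, 'a) lie_algebra = "('k, 'a) module" +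
  bracket :: "'a \<Rightarrow> 'a \<Rightarrow> 'a"

locale lie_algebra = vectorspace K L
  for K :: "('k, 'r) ring_scheme" and L :: "('k, 'a) lie_algebra" (structure) +
  assumes bracket_closed:
      "\<lbrakk>x \<in> carrier L; y \<in> carrier L\<rbrakk> \<Longrightarrow> bracket L x y \<in> carrier L"
    and bracket_add_left:
      "\<lbrakk>x \<in> carrier L; y \<in> carrier L; z \<in> carrier L\<rbrakk>
        \<Longrightarrow> bracket L (x \<oplus> y) z = bracket L x z \<oplus> bracket L y z"
    and bracket_add_right:
      "\<lbrakk>x \<in> carrier L; y \<in> carrier L; z \<in> carrier L\<rbrakk>
        \<Longrightarrow> bracket L x (y \<oplus> z) = bracket L x y \<oplus> bracket L x z"
    and bracket_smult_left:
      "\<lbrakk>c \<in> carrier K; x \<in> carrier L; y \<in> carrier L\<rbrakk>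
        \<Longrightarrow> bracket L (c \<odot> x) y = c \<odot> bracket L x y"
    and bracket_smult_right:
      "\<lbrakk>c \<in> carrier K; x \<in> carrier L; y \<in> carrier L\<rbrakk>
        \<Longrightarrow> bracket L x (c \<odot> y) = c \<odot> bracket L x y"
    and bracket_self: "x \<in> carrier L \<Longrightarrow> bracket L x x = \<zero>"
    and jacobi:
      "\<lbrakk>x \<in> carrier L; y \<in> carrier L; z \<in> carrier L\<rbrakk>
        \<Longrightarrow> bracket L x (bracket L y z) \<oplus> bracket L y (bracket L z x)
              \<oplus> bracket L z (bracket L x y) = \<zero>"

record ('k, 'a, 'm) lie_module = "('k, 'm) module" +
  act :: "'a \<Rightarrow> 'm \<Rightarrow> 'm"

locale lie_module = L?: lie_algebra K L + vectorspace K M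
  for K :: "('k, 'r) ring_scheme" and L :: "('k, 'a) lie_algebra"
    and M :: "('k, 'a, 'm) lie_module" (structure) +
  assumes act_closed: "\<lbrakk>x \<in> carrier L; m \<in> carrier M\<rbrakk> \<Longrightarrow> act M x m \<in> carrier M"
    and act_add_left:
      "\<lbrakk>x \<in> carrier L; y \<in> carrier L; m \<in> carrier M\<rbrakk>
        \<Longrightarrow> act M (x \<oplus>\<^bsub>L\<^esub> y) m = act M x m \<oplus> act M y m"
    and act_smult_left:
      "\<lbrakk>c \<in> carrier K; x \<in> carrier L; m \<in> carrier M\<rbrakk>
        \<Longrightarrow> act M (c \<odot>\<^bsub>L\<^esub> x) m = c \<odot> act M x m"
    and act_add_right:
      "\<lbrakk>x \<in> carrier L; m \<in> carrier M; n \<in> carrier M\<rbrakk>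
        \<Longrightarrow> act M x (m \<oplus> n) = act M x m \<oplus> act M x n"
    and act_smult_right:
      "\<lbrakk>c \<in> carrier K; x \<in> carrier L; m \<in> carrier M\<rbrakk>
        \<Longrightarrow> act M x (c \<odot> m) = c \<odot> act M x m"
    and act_bracket:
      "\<lbrakk>x \<in> carrier L; y \<in> carrier L; m \<in> carrier M\<rbrakk>
        \<Longrightarrow> act M (bracket L x y) m = act M x (act M y m) \<ominus> act M y (act M x m)"

definition lie_submodule ::
  "('k, 'r) ring_scheme \<Rightarrow> ('k, 'a) lie_algebra \<Rightarrow> 'm set \<Rightarrow> ('k, 'a, 'm) lie_module \<Rightarrow> bool"
where
  "lie_submodule K L N M \<longleftrightarrow>
     VectorSpace.subspace K N M \<and> (\<forall>x\<in>carrier L. \<forall>n\<in>N. act M x n \<in> N)"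

definition lie_generated ::
  "('k, 'r) ring_scheme \<Rightarrow> ('k, 'a) lie_algebra \<Rightarrow> ('k, 'a, 'm) lie_module \<Rightarrow> 'm set \<Rightarrow> 'm set"
where
  "lie_generated K L M S = \<Inter>{N. lie_submodule K L N M \<and> S \<subseteq> N}"

definition locally_finite ::
  "('k, 'r) ring_scheme \<Rightarrow> ('k, 'a) lie_algebra \<Rightarrow> ('k, 'a, 'm) lie_module \<Rightarrow> bool"
where
  "locally_finite K L M \<longleftrightarrow>
     (\<forall>S. finite S \<and> S \<subseteq> carrier M
        \<longrightarrow> vectorspace.fin_dim K (M\<lparr>carrier := lie_generated K L M S\<rparr>))"

definition lie_hom ::
  "('k, 'r) ring_scheme \<Rightarrow> ('k, 'a) lie_algebra \<Rightarrow> ('k, 'a, 'm) lie_module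
     \<Rightarrow> ('k, 'a, 'n) lie_module \<Rightarrow> ('m \<Rightarrow> 'n) set"
where
  "lie_hom K L M N =
     {f \<in> LinearCombinations.module_hom K M N. \<forall>x\<in>carrier L. \<forall>m\<in>carrier M. f (act M x m) = act N x (f m)}"

section \<open>Injective hulls\<close>

text \<open>
  A module over \<open>L\<close> is a unital module over the enveloping algebra \<open>U(L)\<close>, so injectivity is
  formulated in the category of all \<open>L\<close>-modules.  HOL cannot quantify over types inside a formula,
  so the test modules \<open>A\<close> and \<open>B\<close> have their carriers in one fixed type.  Its elements are lists
  \<open>[(k\<^sub>1, w\<^sub>1), \<dots>, (k\<^sub>n, w\<^sub>n)]\<close>, i.e. formal \<open>K\<close>-linear combinations of words in \<open>L\<close>;
  as these represent every element of \<open>U(L)\<close>, the type is large enough for every cyclic module.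
  Lemma \<open>lie_injective_extend\<close> below shows (by the argument of Baer's criterion) that the
  extension property then holds for test modules over arbitrary types, so that the choice of type
  does not affect the notion.
\<close>

definition lie_injective ::
  "('k, 'r) ring_scheme \<Rightarrow> ('k, 'a) lie_algebra \<Rightarrow> ('k, 'a, 'e) lie_module \<Rightarrow> bool"
where
  "lie_injective K L E \<longleftrightarrow> lie_module K L E \<and>
     (\<forall>(A :: ('k, 'a, ('k \<times> 'a list) list) lie_module) (B :: ('k, 'a, ('k \<times> 'a list) list) lie_module).
        \<forall>i f. lie_module K L A \<and> lie_module K L B
          \<and> i \<in> lie_hom K L A B \<and> inj_on i (carrier A) \<and> f \<in> lie_hom K L A E
          \<longrightarrow> (\<exists>g\<in>lie_hom K L B E. \<forall>a\<in>carrier A. g (i a) = f a))"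

definition essential_submodule ::
  "('k, 'r) ring_scheme \<Rightarrow> ('k, 'a) lie_algebra \<Rightarrow> 'e set \<Rightarrow> ('k, 'a, 'e) lie_module \<Rightarrow> bool"
where
  "essential_submodule K L N E \<longleftrightarrow> lie_submodule K L N E \<and>
     (\<forall>X. lie_submodule K L X E \<and> X \<noteq> {\<zero>\<^bsub>E\<^esub>} \<longrightarrow> X \<inter> N \<noteq> {\<zero>\<^bsub>E\<^esub>})"

definition injective_hull ::
  "('k, 'r) ring_scheme \<Rightarrow> ('k, 'a) lie_algebra \<Rightarrow> ('k, 'a, 'm) lie_module
     \<Rightarrow> ('k, 'a, 'e) lie_module \<Rightarrow> ('m \<Rightarrow> 'e) \<Rightarrow> bool"
where
  "injective_hull K L M E \<iota> \<longleftrightarrow>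
     lie_injective K L E \<and> \<iota> \<in> lie_hom K L M E \<and> inj_on \<iota> (carrier M)
       \<and> essential_submodule K L (\<iota> ` carrier M) E"

text \<open>The characteristic is the additive order of \<open>\<one>\<close>; it is \<open>0\<close> if that order is infinite.\<close>

definition characteristic :: "('k, 'r) ring_scheme \<Rightarrow> nat" where
  "characteristic K = group.ord (add_monoid K) \<one>\<^bsub>K\<^esub>"

section \<open>Independence of the type of the test modules\<close>

lemma lie_homI:
  assumes "\<And>m. m \<in> carrier M \<Longrightarrow> f m \<in> carrier N"
    and "\<And>m n. \<lbrakk>m \<in> carrier M; n \<in> carrier M\<rbrakk> \<Longrightarrow> f (m \<oplus>\<^bsub>M\<^esub> n) = f m \<oplus>\<^bsub>N\<^esub> f n"
    and "\<And>c m. \<lbrakk>c \<in> carrier K; m \<in> carrier M\<rbrakk> \<Longrightarrow> f (c \<odot>\<^bsub>M\<^esub> m) = c \<odot>\<^bsub>N\<^esub> f m"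
    and "\<And>x m. \<lbrakk>x \<in> carrier L; m \<in> carrier M\<rbrakk> \<Longrightarrow> f (act M x m) = act N x (f m)"
  shows "f \<in> lie_hom K L M N"
  using assms unfolding lie_hom_def LinearCombinations.module_hom_def by auto

lemma lie_homD:
  assumes "f \<in> lie_hom K L M N"
  shows "\<And>m. m \<in> carrier M \<Longrightarrow> f m \<in> carrier N"
    and "\<And>m n. \<lbrakk>m \<in> carrier M; n \<in> carrier M\<rbrakk> \<Longrightarrow> f (m \<oplus>\<^bsub>M\<^esub> n) = f m \<oplus>\<^bsub>N\<^esub> f n"
    and "\<And>c m. \<lbrakk>c \<in> carrier K; m \<in> carrier M\<rbrakk> \<Longrightarrow> f (c \<odot>\<^bsub>M\<^esub> m) = c \<odot>\<^bsub>N\<^esub> f m"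
    and "\<And>x m. \<lbrakk>x \<in> carrier L; m \<in> carrier M\<rbrakk> \<Longrightarrow> f (act M x m) = act N x (f m)"
  using assms unfolding lie_hom_def LinearCombinations.module_hom_def by auto

definition transport ::
  "('k, 'a, 'm) lie_module \<Rightarrow> 'm set \<Rightarrow> ('m \<Rightarrow> 'u) \<Rightarrow> ('u \<Rightarrow> 'm) \<Rightarrow> ('k, 'a, 'u) lie_module"
where
  "transport M N \<phi> \<psi> =
     \<lparr>carrier = \<phi> ` N, mult = (\<lambda>_ _. undefined), one = undefined, zero = \<phi> \<zero>\<^bsub>M\<^esub>,
      add = (\<lambda>x y. \<phi> (\<psi> x \<oplus>\<^bsub>M\<^esub> \<psi> y)), smult = (\<lambda>c x. \<phi> (c \<odot>\<^bsub>M\<^esub> \<psi> x)),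
      act = (\<lambda>x y. \<phi> (act M x (\<psi> y)))\<rparr>"

lemma transport_simps [simp]:
  "carrier (transport M N \<phi> \<psi>) = \<phi> ` N" "zero (transport M N \<phi> \<psi>) = \<phi> \<zero>\<^bsub>M\<^esub>"
  "add (transport M N \<phi> \<psi>) x y = \<phi> (\<psi> x \<oplus>\<^bsub>M\<^esub> \<psi> y)"
  "smult (transport M N \<phi> \<psi>) c x = \<phi> (c \<odot>\<^bsub>M\<^esub> \<psi> x)"
  "act (transport M N \<phi> \<psi>) z x = \<phi> (act M z (\<psi> x))"
  by (simp_all add: transport_def)

lemma lie_module_transport:
  fixes M :: "('k, 'a, 'm) lie_module" (structure)
  assumes M: "lie_module K L M"
    and sub: "N \<subseteq> carrier M" and zero: "\<zero> \<in> N"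
    and add: "\<And>x y. \<lbrakk>x \<in> N; y \<in> N\<rbrakk> \<Longrightarrow> x \<oplus> y \<in> N"
    and smult: "\<And>c x. \<lbrakk>c \<in> carrier K; x \<in> N\<rbrakk> \<Longrightarrow> c \<odot> x \<in> N"
    and act: "\<And>z x. \<lbrakk>z \<in> carrier L; x \<in> N\<rbrakk> \<Longrightarrow> act M z x \<in> N"
    and inv: "\<And>x. x \<in> N \<Longrightarrow> \<psi> (\<phi> x) = x"
  shows "lie_module K L (transport M N \<phi> \<psi>)"
proof -
  interpret M: lie_module K L M by (fact M)
  let ?T = "transport M N \<phi> \<psi>"
  have mem: "x \<in> carrier M" if "x \<in> N" for x using that sub by auto
  have minus: "\<ominus> x \<in> N" if "x \<in> N" for x
    using smult[of "\<ominus>\<^bsub>K\<^esub> \<one>\<^bsub>K\<^esub>" x] that mem M.smult_minus_1 by simp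
  have ag: "abelian_group ?T"
  proof (rule abelian_groupI)
    show "\<exists>y\<in>carrier ?T. y \<oplus>\<^bsub>?T\<^esub> x = \<zero>\<^bsub>?T\<^esub>" if "x \<in> carrier ?T" for x
    proof -
      from that obtain n where n: "n \<in> N" "x = \<phi> n" by auto
      have "\<phi> (\<ominus> n) \<oplus>\<^bsub>?T\<^esub> x = \<zero>\<^bsub>?T\<^esub>" using n minus mem by (simp add: inv M.M.l_neg)
      then show ?thesis using minus n by auto
    qed
  qed (auto simp: inv add zero mem M.M.a_ac)
  have mod: "Module.module K ?T"
    by (rule Module.moduleI)
      (use ag in \<open>auto simp: inv add smult zero mem M.smult_l_distr M.smult_r_distr M.smult_assoc1
        intro: M.R.is_cring\<close>)
  have vs: "vectorspace K ?T"
    unfolding vectorspace_def using mod M.field_axioms by auto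
  interpret T: vectorspace K ?T by (fact vs)
  have neg: "\<ominus>\<^bsub>?T\<^esub> (\<phi> n) = \<phi> (\<ominus> n)" if "n \<in> N" for n
    by (rule T.M.minus_equality) (use that minus mem in \<open>auto simp: inv M.M.l_neg\<close>)
  show ?thesis
  proof (intro lie_module.intro lie_module_axioms.intro)
    fix x y m assume x: "x \<in> carrier L" and y: "y \<in> carrier L" and "m \<in> carrier ?T"
    then obtain n where n: "n \<in> N" "m = \<phi> n" by auto
    have "act ?T x (act ?T y m) \<ominus>\<^bsub>?T\<^esub> act ?T y (act ?T x m)
        = \<phi> (act M x (act M y n)) \<oplus>\<^bsub>?T\<^esub> \<phi> (\<ominus> act M y (act M x n))"
      using n x y by (simp add: inv act neg a_minus_def)
    also have "\<dots> = \<phi> (act M (bracket L x y) n)"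
      using n x y by (simp add: inv act minus M.act_bracket mem a_minus_def)
    finally show "act ?T (bracket L x y) m
        = act ?T x (act ?T y m) \<ominus>\<^bsub>?T\<^esub> act ?T y (act ?T x m)"
      using n by (simp add: inv)
  qed (use vs M.lie_algebra_axioms in \<open>auto simp: inv add smult zero act mem M.act_add_left
      M.act_add_right M.act_smult_left M.act_smult_right\<close>)
qed

fun formal_eval ::
  "('k, 'a, 'm) lie_module \<Rightarrow> 'm \<Rightarrow> ('k \<times> 'a list) list \<Rightarrow> 'm"
where
  "formal_eval M b [] = \<zero>\<^bsub>M\<^esub>"
| "formal_eval M b ((k, w) # u) = k \<odot>\<^bsub>M\<^esub> foldr (act M) w b \<oplus>\<^bsub>M\<^esub> formal_eval M b u"

definition formal_words :: "('k, 'r) ring_scheme \<Rightarrow> ('k, 'a) lie_algebra \<Rightarrow> ('k \<times> 'a list) list set"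
where
  "formal_words K L = lists (carrier K \<times> lists (carrier L))"

lemma formal_words_simps [simp]:
  "[] \<in> formal_words K L"
  "(k, w) # u \<in> formal_words K L
     \<longleftrightarrow> k \<in> carrier K \<and> w \<in> lists (carrier L) \<and> u \<in> formal_words K L"
  by (auto simp: formal_words_def)

context lie_module
begin

lemma word_closed: "\<lbrakk>w \<in> lists (carrier L); b \<in> carrier M\<rbrakk> \<Longrightarrow> foldr (act M) w b \<in> carrier M"
  by (induction w) (auto intro: act_closed)

lemma formal_eval_closed:
  "\<lbrakk>u \<in> formal_words K L; b \<in> carrier M\<rbrakk> \<Longrightarrow> formal_eval M b u \<in> carrier M"
  by (induction u) (auto simp: word_closed)

lemma formal_eval_append:
  "\<lbrakk>u \<in> formal_words K L; v \<in> formal_words K L; b \<in> carrier M\<rbrakk>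
     \<Longrightarrow> formal_eval M b u \<oplus> formal_eval M b v = formal_eval M b (u @ v)"
  by (induction u) (auto simp: word_closed formal_eval_closed M.a_assoc)

lemma formal_eval_smult:
  "\<lbrakk>u \<in> formal_words K L; c \<in> carrier K; b \<in> carrier M\<rbrakk>
     \<Longrightarrow> c \<odot> formal_eval M b u = formal_eval M b (map (\<lambda>(k, w). (c \<otimes>\<^bsub>K\<^esub> k, w)) u)"
  by (induction u) (auto simp: word_closed formal_eval_closed smult_r_distr smult_assoc1)

lemma act_zero: "x \<in> carrier L \<Longrightarrow> act M x \<zero> = \<zero>"
  using act_smult_right[of "\<zero>\<^bsub>K\<^esub>" x "\<zero>"] act_closed[of x \<zero>] by simp

lemma formal_eval_act:
  "\<lbrakk>u \<in> formal_words K L; x \<in> carrier L; b \<in> carrier M\<rbrakk>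
     \<Longrightarrow> act M x (formal_eval M b u) = formal_eval M b (map (\<lambda>(k, w). (k, x # w)) u)"
  by (induction u)
    (auto simp: word_closed formal_eval_closed act_zero act_add_right act_smult_right)

lemma formal_words_range:
  assumes b: "b \<in> carrier M"
  defines "C \<equiv> formal_eval M b ` formal_words K L"
  shows "C \<subseteq> carrier M" "\<zero> \<in> C" "b \<in> C"
    and "\<And>x y. \<lbrakk>x \<in> C; y \<in> C\<rbrakk> \<Longrightarrow> x \<oplus> y \<in> C"
    and "\<And>c x. \<lbrakk>c \<in> carrier K; x \<in> C\<rbrakk> \<Longrightarrow> c \<odot> x \<in> C"
    and "\<And>z x. \<lbrakk>z \<in> carrier L; x \<in> C\<rbrakk> \<Longrightarrow> act M z x \<in> C"
proof -
  show "C \<subseteq> carrier M" using b by (auto simp: C_def formal_eval_closed)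
  show "\<zero> \<in> C" unfolding C_def by (rule image_eqI[of _ _ "[]"]) auto
  show "b \<in> C" unfolding C_def by (rule image_eqI[of _ _ "[(\<one>\<^bsub>K\<^esub>, [])]"]) (use b in auto)
next
  fix x y assume "x \<in> C" "y \<in> C"
  then obtain u v where uv: "u \<in> formal_words K L" "x = formal_eval M b u"
      "v \<in> formal_words K L" "y = formal_eval M b v" by (auto simp: C_def)
  have "u @ v \<in> formal_words K L" using uv by (auto simp: formal_words_def)
  then show "x \<oplus> y \<in> C" using uv b by (auto simp: C_def formal_eval_append)
next
  fix c x assume c: "c \<in> carrier K" and "x \<in> C"
  then obtain u where u: "u \<in> formal_words K L" "x = formal_eval M b u" by (auto simp: C_def)
  have "map (\<lambda>(k, w). (c \<otimes>\<^bsub>K\<^esub> k, w)) u \<in> formal_words K L"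
    using u(1) c by (induction u) auto
  then show "c \<odot> x \<in> C" using u b c by (auto simp: C_def formal_eval_smult)
next
  fix z x assume z: "z \<in> carrier L" and "x \<in> C"
  then obtain u where u: "u \<in> formal_words K L" "x = formal_eval M b u" by (auto simp: C_def)
  have "map (\<lambda>(k, w). (k, z # w)) u \<in> formal_words K L"
    using u(1) z by (induction u) auto
  then show "act M z x \<in> C" using u b z by (auto simp: C_def formal_eval_act)
qed

end

lemma (in abelian_group) sum_eq_iff_diff_eq:
  assumes "a \<in> carrier G" "b \<in> carrier G" "c \<in> carrier G" "d \<in> carrier G"
  shows "a \<oplus> b = c \<oplus> d \<longleftrightarrow> d \<oplus> \<ominus> b = a \<oplus> \<ominus> c"
proof -
  have "d \<oplus> \<ominus> b = a \<oplus> \<ominus> c \<longleftrightarrow> (b \<oplus> c) \<oplus> (d \<oplus> \<ominus> b) = (b \<oplus> c) \<oplus> (a \<oplus> \<ominus> c)"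
    using assms by simp
  also have "(b \<oplus> c) \<oplus> (d \<oplus> \<ominus> b) = (c \<oplus> d) \<oplus> (b \<oplus> \<ominus> b)"
    using assms by (simp only: a_ac a_closed a_inv_closed)
  also have "(b \<oplus> c) \<oplus> (a \<oplus> \<ominus> c) = (a \<oplus> b) \<oplus> (c \<oplus> \<ominus> c)"
    using assms by (simp only: a_ac a_closed a_inv_closed)
  finally show ?thesis using assms by (auto simp: r_neg)
qed

lemma lie_injective_extend:
  fixes E :: "('k, 'a, 'e) lie_module"
    and A :: "('k, 'a, 'b) lie_module" and B :: "('k, 'a, 'c) lie_module"
  assumes inj: "lie_injective K L E"
    and A: "lie_module K L A" and B: "lie_module K L B"
    and i: "i \<in> lie_hom K L A B" "inj_on i (carrier A)"
    and f: "f \<in> lie_hom K L A E"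
  shows "\<exists>g\<in>lie_hom K L B E. \<forall>a\<in>carrier A. g (i a) = f a"
proof -
  have E: "lie_module K L E" using inj by (simp add: lie_injective_def)
  interpret A: lie_module K L A by (fact A)
  interpret B: lie_module K L B by (fact B)
  interpret E: lie_module K L E by (fact E)
  define lin where "lin G \<longleftrightarrow> G \<subseteq> carrier B \<times> carrier E \<and> (\<zero>\<^bsub>B\<^esub>, \<zero>\<^bsub>E\<^esub>) \<in> G
      \<and> (\<forall>b e b' e'. (b, e) \<in> G \<longrightarrow> (b', e') \<in> G \<longrightarrow> (b \<oplus>\<^bsub>B\<^esub> b', e \<oplus>\<^bsub>E\<^esub> e') \<in> G)
      \<and> (\<forall>c b e. c \<in> carrier K \<longrightarrow> (b, e) \<in> G \<longrightarrow> (c \<odot>\<^bsub>B\<^esub> b, c \<odot>\<^bsub>E\<^esub> e) \<in> G)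
      \<and> (\<forall>x b e. x \<in> carrier L \<longrightarrow> (b, e) \<in> G \<longrightarrow> (act B x b, act E x e) \<in> G)" for G
  have lin_add: "(b \<oplus>\<^bsub>B\<^esub> b', e \<oplus>\<^bsub>E\<^esub> e') \<in> G" if "lin G" "(b, e) \<in> G" "(b', e') \<in> G" for G b e b' e'
    using that by (simp add: lin_def)
  have lin_smult: "(c \<odot>\<^bsub>B\<^esub> b, c \<odot>\<^bsub>E\<^esub> e) \<in> G" if "lin G" "c \<in> carrier K" "(b, e) \<in> G" for G c b e
    using that by (simp add: lin_def)
  have lin_act: "(act B x b, act E x e) \<in> G" if "lin G" "x \<in> carrier L" "(b, e) \<in> G" for G x b e
    using that by (simp add: lin_def)
  define fn where "fn G \<longleftrightarrow> (\<forall>b e e'. (b, e) \<in> G \<longrightarrow> (b, e') \<in> G \<longrightarrow> e = e')" for G :: "('c \<times> 'e) set"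
  define G0 where "G0 = (\<lambda>a. (i a, f a)) ` carrier A"
  define X where "X = {G. lin G \<and> fn G \<and> G0 \<subseteq> G}"
  note iD = lie_homD[OF i(1)] and fD = lie_homD[OF f]
  have i0: "i \<zero>\<^bsub>A\<^esub> = \<zero>\<^bsub>B\<^esub>" using iD(3)[of "\<zero>\<^bsub>K\<^esub>" "\<zero>\<^bsub>A\<^esub>"] iD(1)[of "\<zero>\<^bsub>A\<^esub>"] by simp
  have f0: "f \<zero>\<^bsub>A\<^esub> = \<zero>\<^bsub>E\<^esub>" using fD(3)[of "\<zero>\<^bsub>K\<^esub>" "\<zero>\<^bsub>A\<^esub>"] fD(1)[of "\<zero>\<^bsub>A\<^esub>"] by simp
  have "lin G0"
    unfolding lin_def
  proof (intro conjI allI impI)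
    show "G0 \<subseteq> carrier B \<times> carrier E" using iD fD by (auto simp: G0_def)
    show "(\<zero>\<^bsub>B\<^esub>, \<zero>\<^bsub>E\<^esub>) \<in> G0"
      unfolding G0_def by (rule image_eqI[of _ _ "\<zero>\<^bsub>A\<^esub>"]) (simp_all add: i0 f0)
    show "(b \<oplus>\<^bsub>B\<^esub> b', e \<oplus>\<^bsub>E\<^esub> e') \<in> G0" if "(b, e) \<in> G0" "(b', e') \<in> G0" for b e b' e'
    proof -
      from that obtain a a' where "a \<in> carrier A" "a' \<in> carrier A" "b = i a" "e = f a"
        "b' = i a'" "e' = f a'" by (auto simp: G0_def)
      then show ?thesis
        unfolding G0_def by (intro image_eqI[of _ _ "a \<oplus>\<^bsub>A\<^esub> a'"]) (simp_all add: iD fD)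
    qed
    show "(c \<odot>\<^bsub>B\<^esub> b, c \<odot>\<^bsub>E\<^esub> e) \<in> G0" if "c \<in> carrier K" "(b, e) \<in> G0" for c b e
    proof -
      from that obtain a where "a \<in> carrier A" "b = i a" "e = f a" by (auto simp: G0_def)
      then show ?thesis
        using that unfolding G0_def
        by (intro image_eqI[of _ _ "c \<odot>\<^bsub>A\<^esub> a"]) (simp_all add: iD fD)
    qed
    show "(act B x b, act E x e) \<in> G0" if "x \<in> carrier L" "(b, e) \<in> G0" for x b e
    proof -
      from that obtain a where "a \<in> carrier A" "b = i a" "e = f a" by (auto simp: G0_def)
      then show ?thesis
        using that unfolding G0_def
        by (intro image_eqI[of _ _ "act A x a"]) (simp_all add: iD fD A.act_closed)
    qed
  qed
  moreover have "fn G0"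
    using i(2) by (auto simp: fn_def G0_def inj_on_def)
  ultimately have "X \<noteq> {}" by (auto simp: X_def)
  moreover have "\<Union>CC \<in> X" if ne: "CC \<noteq> {}" and ch: "subset.chain X CC" for CC
  proof -
    have mem: "G \<in> X" if "G \<in> CC" for G using ch that by (auto simp: subset.chain_def)
    have dir: "\<exists>H\<in>CC. p \<in> H \<and> q \<in> H" if "p \<in> \<Union>CC" "q \<in> \<Union>CC" for p q
    proof -
      from that obtain G H where "G \<in> CC" "H \<in> CC" "p \<in> G" "q \<in> H" by auto
      moreover have "G \<subseteq> H \<or> H \<subseteq> G" using ch \<open>G \<in> CC\<close> \<open>H \<in> CC\<close>
        by (auto simp: subset_chain_def)
      ultimately show ?thesis by blast
    qed
    have "lin (\<Union>CC)"
      unfolding lin_def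
    proof (intro conjI allI impI)
      have "G \<subseteq> carrier B \<times> carrier E \<and> (\<zero>\<^bsub>B\<^esub>, \<zero>\<^bsub>E\<^esub>) \<in> G" if "G \<in> CC" for G
        using mem[OF that] by (simp add: X_def lin_def)
      with ne show "\<Union>CC \<subseteq> carrier B \<times> carrier E" "(\<zero>\<^bsub>B\<^esub>, \<zero>\<^bsub>E\<^esub>) \<in> \<Union>CC" by blast+
      show "(b \<oplus>\<^bsub>B\<^esub> b', e \<oplus>\<^bsub>E\<^esub> e') \<in> \<Union>CC" if be: "(b, e) \<in> \<Union>CC" "(b', e') \<in> \<Union>CC" for b e b' e'
      proof -
        from dir[OF be] obtain H where "H \<in> CC" "(b, e) \<in> H" "(b', e') \<in> H" by auto
        moreover from this have "lin H" using mem by (auto simp: X_def)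
        ultimately show ?thesis using lin_add[of H b e b' e'] by blast
      qed
      show "(c \<odot>\<^bsub>B\<^esub> b, c \<odot>\<^bsub>E\<^esub> e) \<in> \<Union>CC" if c: "c \<in> carrier K" "(b, e) \<in> \<Union>CC" for c b e
      proof -
        from c obtain H where "H \<in> CC" "(b, e) \<in> H" by auto
        moreover from this have "lin H" using mem by (auto simp: X_def)
        ultimately show ?thesis using lin_smult[of H, OF _ c(1)] by blast
      qed
      show "(act B x b, act E x e) \<in> \<Union>CC" if x: "x \<in> carrier L" "(b, e) \<in> \<Union>CC" for x b e
      proof -
        from x obtain H where "H \<in> CC" "(b, e) \<in> H" by auto
        moreover from this have "lin H" using mem by (auto simp: X_def)
        ultimately show ?thesis using lin_act[of H, OF _ x(1)] by blast
      qed
    qed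
    moreover have "fn (\<Union>CC)"
      unfolding fn_def
    proof (intro allI impI)
      fix b e e' assume "(b, e) \<in> \<Union>CC" "(b, e') \<in> \<Union>CC"
      from dir[OF this] obtain H where "H \<in> CC" "(b, e) \<in> H" "(b, e') \<in> H" by auto
      moreover from this have "fn H" using mem by (auto simp: X_def)
      ultimately show "e = e'" unfolding fn_def by blast
    qed
    moreover have "G0 \<subseteq> \<Union>CC" using ne mem by (auto simp: X_def)
    ultimately show ?thesis by (simp add: X_def)
  qed
  ultimately have "\<exists>M\<in>X. \<forall>Y\<in>X. M \<subseteq> Y \<longrightarrow> Y = M" by (rule subset_Zorn_nonempty)
  then obtain G where GX: "G \<in> X" and max: "\<And>Y. \<lbrakk>Y \<in> X; G \<subseteq> Y\<rbrakk> \<Longrightarrow> Y = G" by blast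
  have G: "lin G" "fn G" "G0 \<subseteq> G" using GX by (auto simp: X_def)
  define h where "h b = (THE e. (b, e) \<in> G)" for b
  have h: "h b = e" if "(b, e) \<in> G" for b e
    unfolding h_def using that G(2) by (intro the_equality) (auto simp: fn_def)
  have hG: "(b, h b) \<in> G" if "b \<in> Domain G" for b using that h by fastforce
  have G_sub: "b \<in> carrier B" "e \<in> carrier E" if "(b, e) \<in> G" for b e
    using that G(1) by (auto simp: lin_def)
  have G_0: "(\<zero>\<^bsub>B\<^esub>, \<zero>\<^bsub>E\<^esub>) \<in> G" using G(1) by (simp add: lin_def)
  note G_add = lin_add[OF G(1)] and G_smult = lin_smult[OF G(1)] and G_act = lin_act[OF G(1)]
  have dom: "b \<in> Domain G" if b: "b \<in> carrier B" for b
  proof -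
    define C where "C = formal_eval B b ` formal_words K L"
    note C = B.formal_words_range[OF b, folded C_def]
    define \<phi> where "\<phi> = inv_into (formal_words K L) (formal_eval B b)"
    define \<psi> where "\<psi> = formal_eval B b"
    have inv: "\<psi> (\<phi> c) = c" if "c \<in> C" for c
      using that unfolding \<phi>_def \<psi>_def C_def by (rule f_inv_into_f)
    define D where "D = C \<inter> Domain G"
    let ?C = "transport B C \<phi> \<psi>" and ?D = "transport B D \<phi> \<psi>"
    have lmC: "lie_module K L ?C"
      by (rule lie_module_transport[OF B]) (use C inv in auto)
    have Dcl: "D \<subseteq> carrier B" "\<zero>\<^bsub>B\<^esub> \<in> D"
      using C(1,2) G_0 unfolding D_def by auto
    have D_add: "x \<oplus>\<^bsub>B\<^esub> y \<in> D" if "x \<in> D" "y \<in> D" for x y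
      using that C(4) DomainI[OF G_add[OF hG hG]] by (simp add: D_def)
    have D_smult: "c \<odot>\<^bsub>B\<^esub> x \<in> D" if "c \<in> carrier K" "x \<in> D" for c x
      using that C(5) DomainI[OF G_smult[OF _ hG]] by (simp add: D_def)
    have D_act: "act B z x \<in> D" if "z \<in> carrier L" "x \<in> D" for z x
      using that C(6) DomainI[OF G_act[OF _ hG]] by (simp add: D_def)
    note Dcl = Dcl D_add D_smult D_act
    have lmD: "lie_module K L ?D"
      by (rule lie_module_transport[OF B]) (use Dcl inv D_def in auto)
    have idh: "(\<lambda>x. x) \<in> lie_hom K L ?D ?C"
      by (rule lie_homI) (auto simp: D_def)
    have invD: "\<psi> (\<phi> d) = d" if "d \<in> D" for d using that inv by (auto simp: D_def)
    have "(\<lambda>x. h (\<psi> x)) \<in> lie_hom K L ?D E"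
    proof (rule lie_homI)
      have hd: "(d, h d) \<in> G" if "d \<in> D" for d using that hG by (auto simp: D_def)
      show "h (\<psi> m) \<in> carrier E" if "m \<in> carrier ?D" for m
        using that G_sub(2)[OF hd] invD by auto
      show "h (\<psi> (m \<oplus>\<^bsub>?D\<^esub> n)) = h (\<psi> m) \<oplus>\<^bsub>E\<^esub> h (\<psi> n)" if "m \<in> carrier ?D" "n \<in> carrier ?D" for m n
        using that Dcl invD hd by (auto intro!: h G_add)
      show "h (\<psi> (c \<odot>\<^bsub>?D\<^esub> m)) = c \<odot>\<^bsub>E\<^esub> h (\<psi> m)" if "c \<in> carrier K" "m \<in> carrier ?D" for c m
        using that Dcl invD hd by (auto intro!: h G_smult)
      show "h (\<psi> (act ?D x m)) = act E x (h (\<psi> m))" if "x \<in> carrier L" "m \<in> carrier ?D" for x m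
        using that Dcl invD hd by (auto intro!: h G_act)
    qed
    then obtain g where g: "g \<in> lie_hom K L ?C E" and
        gD: "\<And>d. d \<in> carrier ?D \<Longrightarrow> g d = h (\<psi> d)"
      using inj[unfolded lie_injective_def] lmC lmD idh inj_on_id2 by metis
    define k where "k c = g (\<phi> c)" for c
    note gH = lie_homD[OF g]
    have k1: "k c \<in> carrier E" if "c \<in> C" for c using gH(1) that by (simp add: k_def)
    have k2: "k (c \<oplus>\<^bsub>B\<^esub> d) = k c \<oplus>\<^bsub>E\<^esub> k d" if "c \<in> C" "d \<in> C" for c d
      using gH(2)[of "\<phi> c" "\<phi> d"] that by (simp add: k_def inv)
    have k3: "k (r \<odot>\<^bsub>B\<^esub> c) = r \<odot>\<^bsub>E\<^esub> k c" if "r \<in> carrier K" "c \<in> C" for r c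
      using gH(3)[of r "\<phi> c"] that by (simp add: k_def inv)
    have k4: "k (act B x c) = act E x (k c)" if "x \<in> carrier L" "c \<in> C" for x c
      using gH(4)[of x "\<phi> c"] that by (simp add: k_def inv)
    have k5: "k c = e" if "c \<in> C" "(c, e) \<in> G" for c e
      using that gD[of "\<phi> c"] h[of c e] inv[of c] unfolding k_def D_def by force
    have k0: "k \<zero>\<^bsub>B\<^esub> = \<zero>\<^bsub>E\<^esub>" using k5 C(2) G_0 by blast
    define G' where "G' = {(d \<oplus>\<^bsub>B\<^esub> c, e \<oplus>\<^bsub>E\<^esub> k c) | d c e. (d, e) \<in> G \<and> c \<in> C}"
    have G'I: "(p, q) \<in> G'" if "p = d \<oplus>\<^bsub>B\<^esub> c" "q = e \<oplus>\<^bsub>E\<^esub> k c" "(d, e) \<in> G" "c \<in> C" for p q d c e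
      using that by (auto simp: G'_def)
    have CB: "c \<in> carrier B" if "c \<in> C" for c using that C(1) by auto
    have GG': "G \<subseteq> G'"
    proof
      fix p assume p: "p \<in> G"
      then obtain d e where "p = (d, e)" by (cases p)
      then show "p \<in> G'"
        using p G_sub C(2) by (auto intro!: G'I[of _ d "\<zero>\<^bsub>B\<^esub>" _ e] simp: k0)
    qed
    have "lin G'"
      unfolding lin_def
    proof (intro conjI allI impI)
      show "G' \<subseteq> carrier B \<times> carrier E" using G_sub CB k1 by (auto simp: G'_def)
      show "(\<zero>\<^bsub>B\<^esub>, \<zero>\<^bsub>E\<^esub>) \<in> G'" using GG' G_0 by auto
      show "(p \<oplus>\<^bsub>B\<^esub> p', q \<oplus>\<^bsub>E\<^esub> q') \<in> G'" if "(p, q) \<in> G'" "(p', q') \<in> G'" for p q p' q'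
      proof -
        from that obtain d c e d' c' e' where *: "(d, e) \<in> G" "c \<in> C" "(d', e') \<in> G" "c' \<in> C"
          "p = d \<oplus>\<^bsub>B\<^esub> c" "q = e \<oplus>\<^bsub>E\<^esub> k c" "p' = d' \<oplus>\<^bsub>B\<^esub> c'" "q' = e' \<oplus>\<^bsub>E\<^esub> k c'"
          by (auto simp: G'_def)
        show ?thesis
          by (rule G'I[of _ "d \<oplus>\<^bsub>B\<^esub> d'" "c \<oplus>\<^bsub>B\<^esub> c'" _ "e \<oplus>\<^bsub>E\<^esub> e'"])
            (use * G_sub G_add C CB k1 in \<open>auto simp: k2 B.M.a_ac E.M.a_ac\<close>)
      qed
      show "(r \<odot>\<^bsub>B\<^esub> p, r \<odot>\<^bsub>E\<^esub> q) \<in> G'" if "r \<in> carrier K" "(p, q) \<in> G'" for r p q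
      proof -
        from that obtain d c e where *: "(d, e) \<in> G" "c \<in> C" "p = d \<oplus>\<^bsub>B\<^esub> c" "q = e \<oplus>\<^bsub>E\<^esub> k c"
          by (auto simp: G'_def)
        show ?thesis
          by (rule G'I[of _ "r \<odot>\<^bsub>B\<^esub> d" "r \<odot>\<^bsub>B\<^esub> c" _ "r \<odot>\<^bsub>E\<^esub> e"])
            (use that * G_sub G_smult C CB k1 in \<open>auto simp: k3 B.smult_r_distr E.smult_r_distr\<close>)
      qed
      show "(act B x p, act E x q) \<in> G'" if "x \<in> carrier L" "(p, q) \<in> G'" for x p q
      proof -
        from that obtain d c e where *: "(d, e) \<in> G" "c \<in> C" "p = d \<oplus>\<^bsub>B\<^esub> c" "q = e \<oplus>\<^bsub>E\<^esub> k c"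
          by (auto simp: G'_def)
        show ?thesis
          by (rule G'I[of _ "act B x d" "act B x c" _ "act E x e"])
            (use that * G_sub G_act C CB k1 in \<open>auto simp: k4 B.act_add_right E.act_add_right\<close>)
      qed
    qed
    moreover have "fn G'"
    proof -
      have "q = q'" if "(p, q) \<in> G'" "(p, q') \<in> G'" for p q q'
      proof -
        from that obtain d c e d' c' e' where *: "(d, e) \<in> G" "c \<in> C" "(d', e') \<in> G" "c' \<in> C"
          "d \<oplus>\<^bsub>B\<^esub> c = d' \<oplus>\<^bsub>B\<^esub> c'" "q = e \<oplus>\<^bsub>E\<^esub> k c" "q' = e' \<oplus>\<^bsub>E\<^esub> k c'"
          unfolding G'_def by blast
        let ?m = "\<ominus>\<^bsub>K\<^esub> \<one>\<^bsub>K\<^esub>"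
        have m: "?m \<in> carrier K" by simp
        note cB = G_sub(1)[OF *(1)] G_sub(1)[OF *(3)] CB[OF *(2)] CB[OF *(4)]
        note cE = G_sub(2)[OF *(1)] G_sub(2)[OF *(3)] k1[OF *(2)] k1[OF *(4)]
        have "c' \<oplus>\<^bsub>B\<^esub> \<ominus>\<^bsub>B\<^esub> c = d \<oplus>\<^bsub>B\<^esub> \<ominus>\<^bsub>B\<^esub> d'"
          using *(5) B.M.sum_eq_iff_diff_eq[OF cB(1,3,2,4)] by blast
        then have eq: "d \<oplus>\<^bsub>B\<^esub> ?m \<odot>\<^bsub>B\<^esub> d' = c' \<oplus>\<^bsub>B\<^esub> ?m \<odot>\<^bsub>B\<^esub> c"
          using cB by (simp add: B.smult_minus_1)
        have "(d \<oplus>\<^bsub>B\<^esub> ?m \<odot>\<^bsub>B\<^esub> d', e \<oplus>\<^bsub>E\<^esub> ?m \<odot>\<^bsub>E\<^esub> e') \<in> G"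
          by (intro G_add G_smult m *)
        then have "k (c' \<oplus>\<^bsub>B\<^esub> ?m \<odot>\<^bsub>B\<^esub> c) = e \<oplus>\<^bsub>E\<^esub> ?m \<odot>\<^bsub>E\<^esub> e'"
          unfolding eq by (intro k5 C *(2) *(4) m)
        then have kk: "k c' \<oplus>\<^bsub>E\<^esub> \<ominus>\<^bsub>E\<^esub> (k c) = e \<oplus>\<^bsub>E\<^esub> \<ominus>\<^bsub>E\<^esub> e'"
          using *(2,4) m C cE by (simp add: k2 k3 E.smult_minus_1)
        have "e \<oplus>\<^bsub>E\<^esub> k c = e' \<oplus>\<^bsub>E\<^esub> k c'"
          using kk E.M.sum_eq_iff_diff_eq[OF cE(1,3,2,4)] by blast
        then show ?thesis using *(6,7) by simp
      qed
      then show ?thesis unfolding fn_def by blast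
    qed
    ultimately have "G' \<in> X" using G(3) GG' by (auto simp: X_def)
    from max[OF this GG'] have "G' = G" .
    moreover have "(b, k b) \<in> G'"
      by (rule G'I[of _ "\<zero>\<^bsub>B\<^esub>" b _ "\<zero>\<^bsub>E\<^esub>"]) (use b G_0 C(3) k1 in auto)
    ultimately show ?thesis by auto
  qed
  show ?thesis
  proof (intro bexI ballI)
    show "h (i a) = f a" if "a \<in> carrier A" for a
      by (rule h) (use that G(3) G0_def in auto)
    show "h \<in> lie_hom K L B E"
      by (rule lie_homI) (use hG[OF dom] in \<open>auto intro!: h G_add G_smult G_act intro: G_sub(2)\<close>)
  qed
qed

end

theory Submission
  imports Defs
begin

text \<open>
  Local finiteness passes to every essential extension \<open>E\<close> of a locally finite module \<open>M\<close>, and an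
  injective hull is an essential extension.  So let \<open>V\<close> be the submodule of \<open>E\<close> generated by a finite
  set; it has to be shown that \<open>V\<close> is finite-dimensional.

  Prime characteristic makes the enveloping algebra finite over a central subalgebra.  For \<open>x\<close> in the
  Lie algebra the operators \<open>ad x, (ad x)^p, (ad x)^(p^2), \<dots>\<close> are linearly dependent, so there is a monic
  p-polynomial \<open>q\<close> with \<open>q(ad x) = 0\<close>; since \<open>p\<close>-th powers of derivations are derivations in
  characteristic \<open>p\<close>, the operator \<open>q(x)\<close> commutes with the action of the Lie algebra (lemmas
  \<open>p_polynomial_leibniz\<close> and \<open>central_p_polynomial\<close>).  Taking one such operator \<open>z\<^sub>b\<close> for each
  element \<open>b\<close> of a finite spanning set, \<open>V\<close> is generated by a finite-dimensional subspace under
  the commuting operators \<open>z\<^sub>b\<close>, because words in the Lie algebra can be reordered modulo shorter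
  words (lemma \<open>filtration_generated\<close>).

  By Hilbert's basis theorem for commuting operators (lemma \<open>hilbert_basis_step\<close>), \<open>V\<close> satisfies the
  ascending chain condition on submodules.  Hence \<open>V \<inter> M\<close>, being locally finite, is
  finite-dimensional (lemma \<open>generated_locally_finite_inter\<close>).  Now the p-polynomials can be chosen
  anew so that the operators \<open>z\<^sub>b\<close> are not only central but also annihilate \<open>V \<inter> M\<close> (lemma
  \<open>central_p_polynomial_annihilating\<close>).  By Fitting's lemma the image of a suitable power of
  \<open>z\<^sub>b\<close> on \<open>V\<close> meets \<open>V \<inter> M\<close> only in zero, so it is zero as \<open>M\<close> is essential in \<open>E\<close> (lemma
  \<open>essential_nilpotent\<close>).  Thus \<open>V\<close> is generated by a finite-dimensional space under finitely many
  commuting nilpotent operators, and it is finite-dimensional.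
\<close>

section \<open>Finite-dimensional subspaces\<close>

context vectorspace
begin

lemma subspaceI:
  assumes "N \<subseteq> carrier V" "\<zero>\<^bsub>V\<^esub> \<in> N"
    and "\<And>u v. \<lbrakk>u \<in> N; v \<in> N\<rbrakk> \<Longrightarrow> u \<oplus>\<^bsub>V\<^esub> v \<in> N"
    and "\<And>c v. \<lbrakk>c \<in> carrier K; v \<in> N\<rbrakk> \<Longrightarrow> c \<odot>\<^bsub>V\<^esub> v \<in> N"
  shows "VectorSpace.subspace K N V"
  using assms vectorspace_axioms module_axioms
  unfolding VectorSpace.subspace_def submodule_def by auto

lemma subspaceD:
  assumes "VectorSpace.subspace K N V"
  shows "\<And>v. v \<in> N \<Longrightarrow> v \<in> carrier V" "\<zero>\<^bsub>V\<^esub> \<in> N"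
    and "\<And>u v. \<lbrakk>u \<in> N; v \<in> N\<rbrakk> \<Longrightarrow> u \<oplus>\<^bsub>V\<^esub> v \<in> N"
    and "\<And>c v. \<lbrakk>c \<in> carrier K; v \<in> N\<rbrakk> \<Longrightarrow> c \<odot>\<^bsub>V\<^esub> v \<in> N"
  using assms unfolding VectorSpace.subspace_def submodule_def by auto

lemma subspace_uminus:
  assumes "VectorSpace.subspace K N V" "v \<in> N"
  shows "\<ominus>\<^bsub>V\<^esub> v \<in> N"
  using subspaceD(4)[OF assms(1), of "\<ominus>\<^bsub>K\<^esub> \<one>\<^bsub>K\<^esub>" v] subspaceD(1)[OF assms] assms(2) smult_minus_1
  by simp

lemma subspace_minus:
  assumes "VectorSpace.subspace K N V" "u \<in> N" "v \<in> N"
  shows "u \<ominus>\<^bsub>V\<^esub> v \<in> N"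
  unfolding a_minus_def
  by (rule subspaceD(3)[OF assms(1,2) subspace_uminus[OF assms(1,3)]])

lemma subspace_cancel_right:
  assumes N: "VectorSpace.subspace K N V" and "u \<oplus>\<^bsub>V\<^esub> v \<in> N" "v \<in> N" "u \<in> carrier V"
  shows "u \<in> N"
proof -
  have "(u \<oplus>\<^bsub>V\<^esub> v) \<oplus>\<^bsub>V\<^esub> \<ominus>\<^bsub>V\<^esub> v = u"
    using assms subspaceD(1)[OF N] by (simp add: M.a_assoc M.r_neg)
  then show ?thesis using subspaceD(3)[OF N assms(2) subspace_uminus[OF N assms(3)]] by simp
qed

lemma subspace_carrier: "VectorSpace.subspace K (carrier V) V"
  by (rule subspaceI) auto

lemma subspace_zero: "VectorSpace.subspace K {\<zero>\<^bsub>V\<^esub>} V"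
  by (rule subspaceI) auto

lemma subspace_inter:
  assumes "VectorSpace.subspace K N V" "VectorSpace.subspace K N' V"
  shows "VectorSpace.subspace K (N \<inter> N') V"
  using subspaceD[OF assms(1)] subspaceD[OF assms(2)] by (intro subspaceI) auto

lemma span_least:
  assumes "VectorSpace.subspace K N V" "A \<subseteq> N"
  shows "span A \<subseteq> N"
  using span_is_subset[OF assms(2)] assms(1) by (simp add: VectorSpace.subspace_def)

lemma lin_indpt_card_le:
  assumes "finite A" "lin_indpt A" "finite C" "C \<subseteq> carrier V" "A \<subseteq> span C"
  shows "card A \<le> card C"
  using replacement[OF assms(1,3,4,2,5)] by force

text \<open>
  A condition on a subset of the ambient space rather than on a module record of its own: it
  passes to subsets for free, and lemma \<open>fin_dim_vs_iff\<close> shows that for subspaces it is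
  finite dimension.
\<close>

definition finitely_spanned :: "'c set \<Rightarrow> bool" where
  "finitely_spanned N \<longleftrightarrow> (\<exists>A. finite A \<and> A \<subseteq> carrier V \<and> N \<subseteq> span A)"

lemma finitely_spanned_subset: "\<lbrakk>finitely_spanned N; N' \<subseteq> N\<rbrakk> \<Longrightarrow> finitely_spanned N'"
  unfolding finitely_spanned_def by blast

lemma finitely_spanned_span: "\<lbrakk>finite A; A \<subseteq> carrier V\<rbrakk> \<Longrightarrow> finitely_spanned (span A)"
  unfolding finitely_spanned_def by blast

lemma finitely_spanned_sum:
  assumes "finitely_spanned N" "finitely_spanned N'"
  shows "finitely_spanned {u \<oplus>\<^bsub>V\<^esub> v | u v. u \<in> N \<and> v \<in> N'}"
proof -
  obtain A A' where A: "finite A" "A \<subseteq> carrier V" "N \<subseteq> span A"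
    and A': "finite A'" "A' \<subseteq> carrier V" "N' \<subseteq> span A'"
    using assms by (auto simp: finitely_spanned_def)
  have *: "A \<union> A' \<subseteq> carrier V" using A A' by simp
  have "span A \<subseteq> span (A \<union> A')" "span A' \<subseteq> span (A \<union> A')"
    by (intro span_is_monotone; simp)+
  then have "{u \<oplus>\<^bsub>V\<^esub> v | u v. u \<in> N \<and> v \<in> N'} \<subseteq> span (A \<union> A')"
    using A(3) A'(3) subspaceD(3)[OF span_is_subspace[OF *]] by blast
  then show ?thesis unfolding finitely_spanned_def using * A(1) A'(1) by blast
qed

text \<open>
  The size of a linearly independent subset of \<open>U\<close> is bounded by that of a spanning set of the
  ambient space, so there is a largest one, and by maximality it spans \<open>U\<close>.
\<close>

lemma subspace_finite_spanning_subset: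
  assumes U: "VectorSpace.subspace K U V" and "finitely_spanned U"
  shows "\<exists>B. finite B \<and> B \<subseteq> U \<and> span B = U"
proof -
  obtain C where C: "finite C" "C \<subseteq> carrier V" "U \<subseteq> span C"
    using assms(2) by (auto simp: finitely_spanned_def)
  let ?P = "\<lambda>B. finite B \<and> B \<subseteq> U \<and> lin_indpt B"
  have "?P {}" by (auto simp: lin_dep_def)
  moreover have "card B < Suc (card C)" if "?P B" for B
    using lin_indpt_card_le[of B C] that C by (meson le_imp_less_Suc subset_trans)
  ultimately obtain B where B: "?P B" and max: "\<And>B'. ?P B' \<Longrightarrow> card B' \<le> card B"
    using ex_has_greatest_nat[of ?P "{}" card "Suc (card C)"] by (meson less_imp_le)
  have Bc: "B \<subseteq> carrier V" using B subspaceD(1)[OF U] by blast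
  have "v \<in> span B" if v: "v \<in> U" for v
  proof (rule ccontr)
    assume nv: "v \<notin> span B"
    then have "v \<notin> B" using in_own_span[OF Bc] by blast
    moreover from this have "lin_indpt (B \<union> {v})"
      using lin_dep_iff_in_span[OF Bc _ _ \<open>v \<notin> B\<close>] B nv subspaceD(1)[OF U v] by blast
    ultimately show False using max[of "B \<union> {v}"] B v by simp
  qed
  then have "span B = U" using span_least[OF U] B by blast
  then show ?thesis using B by blast
qed

lemma fin_dim_vs_iff:
  assumes U: "VectorSpace.subspace K U V"
  shows "vectorspace.fin_dim K (V\<lparr>carrier := U\<rparr>) \<longleftrightarrow> finitely_spanned U"
proof -
  interpret U: vectorspace K "V\<lparr>carrier := U\<rparr>" by (rule subspace_is_vs[OF U])
  have eq: "U.span A = span A" if "A \<subseteq> U" for A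
    using span_li_not_depend(1)[OF that] U by (simp add: VectorSpace.subspace_def)
  show ?thesis
  proof
    assume "U.fin_dim"
    then obtain A where "finite A" "A \<subseteq> U" "U.span A = U" by (auto simp: U.fin_dim_def)
    then show "finitely_spanned U"
      using eq[of A] subspaceD(1)[OF U] unfolding finitely_spanned_def by blast
  next
    assume "finitely_spanned U"
    from subspace_finite_spanning_subset[OF U this] show "U.fin_dim"
      using eq by (auto simp: U.fin_dim_def)
  qed
qed

text \<open>
  A finite spanning set of the union of the chain already lies in one of its members.
\<close>

lemma ascending_chain_stable:
  assumes X: "\<And>n::nat. VectorSpace.subspace K (X n) V" "\<And>n. X n \<subseteq> X (Suc n)" "\<And>n. X n \<subseteq> N"
    and N: "finitely_spanned N"
  shows "\<exists>n. \<forall>k\<ge>n. X k = X n"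
proof -
  let ?U = "\<Union>n. X n"
  have mono: "X m \<subseteq> X n" if "m \<le> n" for m n using lift_Suc_mono_le[of X, OF X(2) that] .
  have "VectorSpace.subspace K ?U V"
  proof (rule subspaceI)
    show "u \<oplus>\<^bsub>V\<^esub> v \<in> ?U" if uv: "u \<in> ?U" "v \<in> ?U" for u v
    proof -
      from uv obtain m n where "u \<in> X m" "v \<in> X n" by auto
      then have "u \<in> X (max m n)" "v \<in> X (max m n)" using mono by (meson max.cobounded1 max.cobounded2 subsetD)+
      then show ?thesis using subspaceD(3)[OF X(1)] by blast
    qed
    show "?U \<subseteq> carrier V" using subspaceD(1)[OF X(1)] by blast
    show "\<zero>\<^bsub>V\<^esub> \<in> ?U" using subspaceD(2)[OF X(1)] by blast
    show "c \<odot>\<^bsub>V\<^esub> v \<in> ?U" if "c \<in> carrier K" "v \<in> ?U" for c v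
      using that subspaceD(4)[OF X(1)] by blast
  qed
  moreover have "finitely_spanned ?U" by (rule finitely_spanned_subset[OF N]) (use X(3) in blast)
  ultimately have "\<exists>B. finite B \<and> B \<subseteq> ?U \<and> span B = ?U"
    by (rule subspace_finite_spanning_subset)
  then obtain B where B: "finite B" "B \<subseteq> ?U" "span B = ?U" by blast
  have "\<exists>n. B \<subseteq> X n"
    using B(1,2)
  proof (induction rule: finite_induct)
    case (insert b B)
    then obtain m n where "b \<in> X m" "B \<subseteq> X n" by auto
    then have "insert b B \<subseteq> X (max m n)" using mono[of m "max m n"] mono[of n "max m n"] by auto
    then show ?case ..
  qed auto
  then obtain n where "B \<subseteq> X n" ..
  then have "?U \<subseteq> X n" using span_least[OF X(1)] B(3) by metis
  then show ?thesis using mono by blast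
qed

text \<open>
  The spans of the initial segments form an ascending chain.  This yields the monic linear relation
  from which a central p-polynomial is made.
\<close>

lemma sequence_dependent:
  assumes s: "\<And>i::nat. s i \<in> N" and N: "N \<subseteq> carrier V" "finitely_spanned N"
  shows "\<exists>n. s n \<in> span (s ` {..<n})"
proof -
  let ?X = "\<lambda>n. span (s ` {..<n})"
  obtain A where A: "finite A" "A \<subseteq> carrier V" "N \<subseteq> span A"
    using N(2) by (auto simp: finitely_spanned_def)
  have c: "s ` {..<n} \<subseteq> carrier V" for n using s N(1) by blast
  have "\<exists>n. \<forall>k\<ge>n. ?X k = ?X n"
  proof (rule ascending_chain_stable[OF _ _ _ finitely_spanned_span[OF A(1,2)]])
    show "?X n \<subseteq> ?X (Suc n)" for n by (rule span_is_monotone) auto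
    show "?X n \<subseteq> span A" for n
      by (rule span_least[OF span_is_subspace[OF A(2)]]) (use s A(3) in blast)
  qed (rule span_is_subspace[OF c])
  then obtain n where "?X (Suc n) = ?X n" by (meson le_SucI order_refl)
  moreover have "s n \<in> ?X (Suc n)" using in_own_span[OF c, of "Suc n"] by blast
  ultimately show ?thesis by blast
qed

end

lemma subspace_vimage:
  assumes V: "vectorspace K V" and W: "vectorspace K W"
    and f: "f \<in> LinearCombinations.module_hom K V W" and N: "VectorSpace.subspace K N W"
  shows "VectorSpace.subspace K {v \<in> carrier V. f v \<in> N} V"
proof -
  interpret V: vectorspace K V by (fact V)
  interpret W: vectorspace K W by (fact W)
  interpret f: mod_hom K V W f
    by (intro mod_hom.intro mod_hom_axioms.intro f) unfold_locales
  show ?thesis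
    by (rule V.subspaceI) (use W.subspaceD[OF N] in auto)
qed

lemma subspace_image:
  assumes V: "vectorspace K V" and W: "vectorspace K W"
    and f: "f \<in> LinearCombinations.module_hom K V W" and N: "VectorSpace.subspace K N V"
  shows "VectorSpace.subspace K (f ` N) W"
proof -
  interpret V: vectorspace K V by (fact V)
  interpret W: vectorspace K W by (fact W)
  interpret f: mod_hom K V W f
    by (intro mod_hom.intro mod_hom_axioms.intro f) unfold_locales
  note NV = V.subspaceD[OF N]
  show ?thesis
  proof (rule W.subspaceI)
    show "\<zero>\<^bsub>W\<^esub> \<in> f ` N" using NV(2) f.f0_is_0 by (metis imageI)
    show "u \<oplus>\<^bsub>W\<^esub> v \<in> f ` N" if "u \<in> f ` N" "v \<in> f ` N" for u v
    proof -
      from that obtain u' v' where *: "u' \<in> N" "v' \<in> N" "u = f u'" "v = f v'" by auto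
      then have "u \<oplus>\<^bsub>W\<^esub> v = f (u' \<oplus>\<^bsub>V\<^esub> v')" using NV(1) by simp
      then show ?thesis using NV(3)[OF *(1,2)] by blast
    qed
    show "c \<odot>\<^bsub>W\<^esub> v \<in> f ` N" if c: "c \<in> carrier K" "v \<in> f ` N" for c v
    proof -
      from c obtain v' where *: "v' \<in> N" "v = f v'" by auto
      then have "c \<odot>\<^bsub>W\<^esub> v = f (c \<odot>\<^bsub>V\<^esub> v')" using NV(1) c by simp
      then show ?thesis using NV(4)[OF c(1) *(1)] by blast
    qed
    show "f ` N \<subseteq> carrier W" using NV(1) by auto
  qed
qed

lemma span_image_subset:
  assumes V: "vectorspace K V" and W: "vectorspace K W"
    and f: "f \<in> LinearCombinations.module_hom K V W" and A: "A \<subseteq> carrier V"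
  shows "f ` module.span K V A \<subseteq> module.span K W (f ` A)"
proof -
  interpret V: vectorspace K V by (fact V)
  interpret W: vectorspace K W by (fact W)
  have fA: "f ` A \<subseteq> carrier W"
    using f A by (auto simp: LinearCombinations.module_hom_def)
  have "V.span A \<subseteq> {v \<in> carrier V. f v \<in> W.span (f ` A)}"
    by (rule V.span_least[OF subspace_vimage[OF V W f W.span_is_subspace[OF fA]]])
      (use A W.in_own_span[OF fA] in blast)
  then show ?thesis by blast
qed

lemma finitely_spanned_image:
  assumes V: "vectorspace K V" and W: "vectorspace K W"
    and f: "f \<in> LinearCombinations.module_hom K V W" and N: "vectorspace.finitely_spanned K V N"
  shows "vectorspace.finitely_spanned K W (f ` N)"
proof -
  interpret V: vectorspace K V by (fact V)
  interpret W: vectorspace K W by (fact W)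
  obtain A where A: "finite A" "A \<subseteq> carrier V" "N \<subseteq> V.span A"
    using N by (auto simp: V.finitely_spanned_def)
  have "f ` N \<subseteq> W.span (f ` A)" using A(3) span_image_subset[OF V W f A(2)] by blast
  moreover have "f ` A \<subseteq> carrier W" using f A(2) by (auto simp: LinearCombinations.module_hom_def)
  ultimately show ?thesis using A(1) unfolding W.finitely_spanned_def by blast
qed

section \<open>Hilbert's basis theorem for commuting operators\<close>

text \<open>
  The combinatorial core of Hilbert's basis theorem: a doubly indexed increasing family is stationary
  in its second index, uniformly in the first, because only the finitely many rows below the point
  where the diagonal becomes stationary remain to be considered.
\<close>

lemma double_chain_stable:
  fixes c :: "nat \<Rightarrow> nat \<Rightarrow> 's set"
  assumes mono1: "\<And>n k. c n k \<subseteq> c (Suc n) k" and mono2: "\<And>n k. c n k \<subseteq> c n (Suc k)"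
    and rows: "\<And>n. \<exists>m. \<forall>k\<ge>m. c n k = c n m"
    and diag: "\<exists>m. \<forall>k\<ge>m. c k k = c m m"
  shows "\<exists>m. \<forall>n. \<forall>k\<ge>m. c n k = c n m"
proof -
  have mono: "c n k \<subseteq> c n' k'" if "n \<le> n'" "k \<le> k'" for n k n' k'
    using lift_Suc_mono_le[of "\<lambda>n. c n k", OF mono1 that(1)]
      lift_Suc_mono_le[of "c n'", OF mono2 that(2)] by blast
  obtain d where d: "\<And>k. k \<ge> d \<Longrightarrow> c k k = c d d" using diag by blast
  obtain r where r: "\<And>n k. k \<ge> r n \<Longrightarrow> c n k = c n (r n)" using rows by metis
  define m where "m = Max (insert d (r ` {..<d}))"
  have mr: "r n \<le> m" if "n < d" for n
    unfolding m_def using that by auto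
  have md: "d \<le> m" unfolding m_def by auto
  have "c n k = c n m" if "m \<le> k" for n k
  proof (cases "n < d")
    case True
    then show ?thesis using r[of n k] r[of n m] mr[OF True] that by simp
  next
    case False
    \<comment> \<open>Beyond the point \<open>(d, d)\<close> every entry is squeezed between two diagonal entries.\<close>
    have "c n j = c d d" if "d \<le> j" for j
      using mono[of d n d j] mono[of n "max n j" j "max n j"] d[of "max n j"] False that by auto
    then show ?thesis using md that by simp
  qed
  then show ?thesis by blast
qed

context vectorspace
begin

abbreviation endomorphisms :: "('c \<Rightarrow> 'c) set" where
  "endomorphisms \<equiv> LinearCombinations.module_hom K V V"

lemma endomorphismD:
  assumes "f \<in> endomorphisms"
  shows "\<And>v. v \<in> carrier V \<Longrightarrow> f v \<in> carrier V"
    and "\<And>u v. \<lbrakk>u \<in> carrier V; v \<in> carrier V\<rbrakk> \<Longrightarrow> f (u \<oplus>\<^bsub>V\<^esub> v) = f u \<oplus>\<^bsub>V\<^esub> f v"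
    and "\<And>c v. \<lbrakk>c \<in> carrier K; v \<in> carrier V\<rbrakk> \<Longrightarrow> f (c \<odot>\<^bsub>V\<^esub> v) = c \<odot>\<^bsub>V\<^esub> f v"
  using assms by (auto simp: LinearCombinations.module_hom_def)

lemma endomorphismI:
  assumes "\<And>v. v \<in> carrier V \<Longrightarrow> f v \<in> carrier V"
    and "\<And>u v. \<lbrakk>u \<in> carrier V; v \<in> carrier V\<rbrakk> \<Longrightarrow> f (u \<oplus>\<^bsub>V\<^esub> v) = f u \<oplus>\<^bsub>V\<^esub> f v"
    and "\<And>c v. \<lbrakk>c \<in> carrier K; v \<in> carrier V\<rbrakk> \<Longrightarrow> f (c \<odot>\<^bsub>V\<^esub> v) = c \<odot>\<^bsub>V\<^esub> f v"
  shows "f \<in> endomorphisms"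
  using assms by (auto simp: LinearCombinations.module_hom_def)

lemma endomorphism_zero: "f \<in> endomorphisms \<Longrightarrow> f \<zero>\<^bsub>V\<^esub> = \<zero>\<^bsub>V\<^esub>"
  using endomorphismD(3)[of f "\<zero>\<^bsub>K\<^esub>" "\<zero>\<^bsub>V\<^esub>"] endomorphismD(1)[of f "\<zero>\<^bsub>V\<^esub>"] by simp

lemma endomorphism_funpow: "f \<in> endomorphisms \<Longrightarrow> f ^^ n \<in> endomorphisms"
  by (induction n) (auto intro!: endomorphismI simp: endomorphismD)

lemma funpow_commute:
  assumes "\<And>v. v \<in> carrier V \<Longrightarrow> f v \<in> carrier V" "\<And>v. v \<in> carrier V \<Longrightarrow> g v \<in> carrier V"
    and "\<And>v. v \<in> carrier V \<Longrightarrow> f (g v) = g (f v)" and "v \<in> carrier V"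
  shows "(f ^^ n) v \<in> carrier V \<and> g ((f ^^ n) v) = (f ^^ n) (g v)"
  using assms(4) by (induction n) (auto simp: assms(1,2) assms(3)[symmetric])

definition invariant_subspace :: "('c \<Rightarrow> 'c) set \<Rightarrow> 'c set \<Rightarrow> bool" where
  "invariant_subspace T N \<longleftrightarrow> VectorSpace.subspace K N V \<and> (\<forall>f\<in>T. \<forall>v\<in>N. f v \<in> N)"

text \<open>
  The ascending chain condition for the subspaces of \<open>N\<close> that are invariant under a set of
  operators.  If \<open>N\<close> is itself invariant and the operators commute, this says that \<open>N\<close> is a
  Noetherian module over the polynomial ring in which they are the variables.
\<close>

definition noetherian_under :: "('c \<Rightarrow> 'c) set \<Rightarrow> 'c set \<Rightarrow> bool" where
  "noetherian_under T N \<longleftrightarrow>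
     (\<forall>X::nat \<Rightarrow> 'c set. (\<forall>n. invariant_subspace T (X n) \<and> X n \<subseteq> N \<and> X n \<subseteq> X (Suc n))
        \<longrightarrow> (\<exists>n. \<forall>k\<ge>n. X k = X n))"

lemma noetherian_underD:
  assumes "noetherian_under T N"
    and "\<And>n::nat. invariant_subspace T (X n)" "\<And>n. X n \<subseteq> N" "\<And>n. X n \<subseteq> X (Suc n)"
  shows "\<exists>n. \<forall>k\<ge>n. X k = X n"
  using assms unfolding noetherian_under_def by blast

lemma finitely_spanned_noetherian:
  assumes "finitely_spanned N"
  shows "noetherian_under T N"
  unfolding noetherian_under_def
proof (intro allI impI)
  fix X :: "nat \<Rightarrow> 'c set"
  assume X: "\<forall>n. invariant_subspace T (X n) \<and> X n \<subseteq> N \<and> X n \<subseteq> X (Suc n)"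
  show "\<exists>n. \<forall>k\<ge>n. X k = X n"
    by (rule ascending_chain_stable[OF _ _ _ assms]) (use X in \<open>simp_all add: invariant_subspace_def\<close>)
qed

text \<open>
  The elements \<open>v\<^sub>0 + z v\<^sub>1 + \<dots> + z\<^sup>n\<^sup>-\<^sup>1 v\<^sub>n\<^sub>-\<^sub>1\<close> with coefficients \<open>v\<^sub>i\<close> in \<open>N\<close>: the polynomials
  in \<open>z\<close> of degree less than \<open>n\<close>.
\<close>

fun power_sum :: "('c \<Rightarrow> 'c) \<Rightarrow> 'c set \<Rightarrow> nat \<Rightarrow> 'c set" where
  "power_sum z N 0 = {\<zero>\<^bsub>V\<^esub>}"
| "power_sum z N (Suc n) = {a \<oplus>\<^bsub>V\<^esub> (z ^^ n) v | a v. a \<in> power_sum z N n \<and> v \<in> N}"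

lemma power_sum_invariant:
  assumes z: "z \<in> endomorphisms" and T: "T \<subseteq> endomorphisms" and N: "invariant_subspace T N"
    and comm: "\<And>f v. \<lbrakk>f \<in> T; v \<in> carrier V\<rbrakk> \<Longrightarrow> f (z v) = z (f v)"
  shows "invariant_subspace T (power_sum z N n)"
proof (induction n)
  case 0
  then show ?case using subspace_zero endomorphism_zero T by (auto simp: invariant_subspace_def)
next
  case (Suc n)
  note N' = N[unfolded invariant_subspace_def] and S' = Suc[unfolded invariant_subspace_def]
  note ND = subspaceD[OF N'[THEN conjunct1]] and SD = subspaceD[OF S'[THEN conjunct1]]
  note zn = endomorphismD[OF endomorphism_funpow[OF z, of n]]
  have "VectorSpace.subspace K (power_sum z N (Suc n)) V"
  proof (rule subspaceI)
    show "power_sum z N (Suc n) \<subseteq> carrier V" using SD(1) ND(1) zn(1) by auto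
    show "\<zero>\<^bsub>V\<^esub> \<in> power_sum z N (Suc n)"
      using SD(2) ND(2) endomorphism_zero[OF endomorphism_funpow[OF z, of n]] by force
    show "u \<oplus>\<^bsub>V\<^esub> v \<in> power_sum z N (Suc n)"
      if "u \<in> power_sum z N (Suc n)" "v \<in> power_sum z N (Suc n)" for u v
    proof -
      from that obtain a b a' b' where *: "a \<in> power_sum z N n" "a' \<in> power_sum z N n" "b \<in> N"
        "b' \<in> N" "u = a \<oplus>\<^bsub>V\<^esub> (z ^^ n) b" "v = a' \<oplus>\<^bsub>V\<^esub> (z ^^ n) b'" by auto
      then have "u \<oplus>\<^bsub>V\<^esub> v = (a \<oplus>\<^bsub>V\<^esub> a') \<oplus>\<^bsub>V\<^esub> (z ^^ n) (b \<oplus>\<^bsub>V\<^esub> b')"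
        using SD(1) ND(1) zn(1,2) by (simp add: M.a_ac)
      then show ?thesis using SD(3)[OF *(1,2)] ND(3)[OF *(3,4)] by auto
    qed
    show "c \<odot>\<^bsub>V\<^esub> u \<in> power_sum z N (Suc n)"
      if c: "c \<in> carrier K" and "u \<in> power_sum z N (Suc n)" for c u
    proof -
      from that obtain a b where *: "a \<in> power_sum z N n" "b \<in> N" "u = a \<oplus>\<^bsub>V\<^esub> (z ^^ n) b"
        by auto
      then have "c \<odot>\<^bsub>V\<^esub> u = c \<odot>\<^bsub>V\<^esub> a \<oplus>\<^bsub>V\<^esub> (z ^^ n) (c \<odot>\<^bsub>V\<^esub> b)"
        using SD(1) ND(1) zn(1,3) c by (simp add: smult_r_distr)
      then show ?thesis using SD(4)[OF c *(1)] ND(4)[OF c *(2)] by auto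
    qed
  qed
  moreover have "f u \<in> power_sum z N (Suc n)"
    if f: "f \<in> T" and u: "u \<in> power_sum z N (Suc n)" for f u
  proof -
    from u obtain a b where *: "a \<in> power_sum z N n" "b \<in> N" "u = a \<oplus>\<^bsub>V\<^esub> (z ^^ n) b"
      by auto
    have fE: "f \<in> endomorphisms" using f T by blast
    have "f ((z ^^ n) b) = (z ^^ n) (f b)"
      using funpow_commute[of z f b n] endomorphismD(1)[OF z] endomorphismD(1)[OF fE] comm[OF f]
        ND(1)[OF *(2)] by simp
    then have "f u = f a \<oplus>\<^bsub>V\<^esub> (z ^^ n) (f b)"
      using * SD(1) ND(1) zn(1) endomorphismD(2)[OF fE] by simp
    moreover have "f a \<in> power_sum z N n" "f b \<in> N" using * f N' S' by auto
    ultimately show ?thesis by auto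
  qed
  ultimately show ?case by (simp add: invariant_subspace_def)
qed

lemma power_sum_mono_Suc:
  assumes "z \<in> endomorphisms" "VectorSpace.subspace K N V"
  shows "power_sum z N n \<subseteq> power_sum z N (Suc n)"
proof
  fix a assume a: "a \<in> power_sum z N n"
  have "invariant_subspace {} (power_sum z N n)"
    by (rule power_sum_invariant) (use assms in \<open>auto simp: invariant_subspace_def\<close>)
  then have "a \<in> carrier V" using a subspaceD(1) by (auto simp: invariant_subspace_def)
  then have "a = a \<oplus>\<^bsub>V\<^esub> (z ^^ n) \<zero>\<^bsub>V\<^esub>"
    using endomorphism_zero[OF endomorphism_funpow[OF assms(1)]] by simp
  then show "a \<in> power_sum z N (Suc n)" using a subspaceD(2)[OF assms(2)] by auto
qed

lemma power_sum_shift: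
  assumes z: "z \<in> endomorphisms" and N: "VectorSpace.subspace K N V"
  shows "v \<in> power_sum z N n \<Longrightarrow> z v \<in> power_sum z N (Suc n)"
proof (induction n arbitrary: v)
  case 0
  then show ?case
    using power_sum_mono_Suc[OF z N, of 0] endomorphism_zero[OF z] by auto
next
  case (Suc n)
  then obtain a b where *: "a \<in> power_sum z N n" "b \<in> N" "v = a \<oplus>\<^bsub>V\<^esub> (z ^^ n) b" by auto
  have "invariant_subspace {} (power_sum z N n)"
    by (rule power_sum_invariant) (use z N in \<open>auto simp: invariant_subspace_def\<close>)
  then have "a \<in> carrier V" using *(1) subspaceD(1) by (auto simp: invariant_subspace_def)
  then have "z v = z a \<oplus>\<^bsub>V\<^esub> (z ^^ Suc n) b"
    using *(2,3) endomorphismD(2)[OF z] endomorphismD(1)[OF endomorphism_funpow[OF z]]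
      subspaceD(1)[OF N] by simp
  moreover have "z a \<in> power_sum z N (Suc n)" by (rule Suc.IH[OF *(1)])
  ultimately show ?case unfolding power_sum.simps(2)[of z N "Suc n"] using *(2) by blast
qed

lemma power_sum_1:
  assumes "VectorSpace.subspace K N V"
  shows "N \<subseteq> power_sum z N (Suc 0)"
proof
  fix v assume v: "v \<in> N"
  then have "v = \<zero>\<^bsub>V\<^esub> \<oplus>\<^bsub>V\<^esub> (z ^^ 0) v" using subspaceD(1)[OF assms] by simp
  with v show "v \<in> power_sum z N (Suc 0)" unfolding power_sum.simps by blast
qed

lemma power_sum_finitely_spanned:
  assumes z: "z \<in> endomorphisms" and N: "finitely_spanned N"
  shows "finitely_spanned (power_sum z N n)"
proof (induction n)
  case 0
  then show ?case using in_own_span[of "{\<zero>\<^bsub>V\<^esub>}"] unfolding finitely_spanned_def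
    by (intro exI[of _ "{\<zero>\<^bsub>V\<^esub>}"]) auto
next
  case (Suc n)
  have "power_sum z N (Suc n) = {u \<oplus>\<^bsub>V\<^esub> w | u w. u \<in> power_sum z N n \<and> w \<in> (z ^^ n) ` N}"
    by auto
  moreover have "finitely_spanned ((z ^^ n) ` N)"
    by (rule finitely_spanned_image[OF _ _ endomorphism_funpow[OF z] N]) unfold_locales
  ultimately show ?case using finitely_spanned_sum[OF Suc] by simp
qed

lemma power_sum_Union_invariant:
  assumes z: "z \<in> endomorphisms" and T: "T \<subseteq> endomorphisms" and N: "invariant_subspace T N"
    and comm: "\<And>f v. \<lbrakk>f \<in> T; v \<in> carrier V\<rbrakk> \<Longrightarrow> f (z v) = z (f v)"
  shows "invariant_subspace (insert z T) (\<Union>n. power_sum z N n)"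
proof -
  have inv: "VectorSpace.subspace K (power_sum z N n) V \<and> (\<forall>f\<in>T. \<forall>v\<in>power_sum z N n. f v \<in> power_sum z N n)"
    for n using power_sum_invariant[OF z T N comm] by (simp add: invariant_subspace_def)
  note sub = subspaceD[OF conjunct1[OF inv]]
  have NV: "VectorSpace.subspace K N V" using N by (simp add: invariant_subspace_def)
  have mono: "power_sum z N m \<subseteq> power_sum z N n" if "m \<le> n" for m n
    using lift_Suc_mono_le[of "power_sum z N", OF power_sum_mono_Suc[OF z NV] that] .
  have "VectorSpace.subspace K (\<Union>n. power_sum z N n) V"
  proof (rule subspaceI)
    show "(\<Union>n. power_sum z N n) \<subseteq> carrier V" using sub(1) by blast
    show "\<zero>\<^bsub>V\<^esub> \<in> (\<Union>n. power_sum z N n)" using sub(2) by blast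
    show "u \<oplus>\<^bsub>V\<^esub> v \<in> (\<Union>n. power_sum z N n)"
      if uv: "u \<in> (\<Union>n. power_sum z N n)" "v \<in> (\<Union>n. power_sum z N n)" for u v
    proof -
      from uv obtain m n where "u \<in> power_sum z N m" "v \<in> power_sum z N n" by blast
      then have "u \<in> power_sum z N (max m n)" "v \<in> power_sum z N (max m n)"
        using mono[of m "max m n"] mono[of n "max m n"] by auto
      then show ?thesis using sub(3) by blast
    qed
    show "c \<odot>\<^bsub>V\<^esub> v \<in> (\<Union>n. power_sum z N n)"
      if "c \<in> carrier K" "v \<in> (\<Union>n. power_sum z N n)" for c v
      using that sub(4) by blast
  qed
  moreover have "f v \<in> (\<Union>n. power_sum z N n)"
    if "f \<in> insert z T" "v \<in> (\<Union>n. power_sum z N n)" for f v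
  proof (cases "f = z")
    case True
    then show ?thesis using that(2) power_sum_shift[OF z NV] by blast
  next
    case False
    then show ?thesis using that inv by blast
  qed
  ultimately show ?thesis by (simp add: invariant_subspace_def)
qed

text \<open>
  Hilbert's argument with leading coefficients.  An invariant subspace \<open>X\<close> determines, for every
  degree \<open>n\<close>, the subspace of \<open>N\<close> of those \<open>v\<close> for which \<open>z\<^sup>n v\<close> is the leading term of an element
  of \<open>X\<close>.  These subspaces grow with \<open>n\<close> (apply \<open>z\<close>) and with \<open>X\<close>, and an inclusion between two
  invariant subspaces with the same leading coefficients is an equality, by induction on the degree.
\<close>

lemma hilbert_basis_step:
  assumes z: "z \<in> endomorphisms" and T: "T \<subseteq> endomorphisms" and N: "invariant_subspace T N"
    and comm: "\<And>f v. \<lbrakk>f \<in> T; v \<in> carrier V\<rbrakk> \<Longrightarrow> f (z v) = z (f v)"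
    and noeth: "noetherian_under T N"
  shows "noetherian_under (insert z T) (\<Union>n. power_sum z N n)"
  unfolding noetherian_under_def
proof (intro allI impI)
  fix X :: "nat \<Rightarrow> 'c set"
  assume asm: "\<forall>n. invariant_subspace (insert z T) (X n) \<and> X n \<subseteq> (\<Union>n. power_sum z N n)
      \<and> X n \<subseteq> X (Suc n)"
  have XD: "VectorSpace.subspace K (X k) V" "\<And>f v. \<lbrakk>f \<in> insert z T; v \<in> X k\<rbrakk> \<Longrightarrow> f v \<in> X k"
    "X k \<subseteq> (\<Union>n. power_sum z N n)" "X k \<subseteq> X (Suc k)" for k
    using asm by (auto simp: invariant_subspace_def)
  have NV: "VectorSpace.subspace K N V" and NT: "\<And>f v. \<lbrakk>f \<in> T; v \<in> N\<rbrakk> \<Longrightarrow> f v \<in> N"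
    using N by (auto simp: invariant_subspace_def)
  note ND = subspaceD[OF NV]
  note Xsub = subspaceD[OF XD(1)]
  have inv: "VectorSpace.subspace K (power_sum z N n) V \<and> (\<forall>f\<in>T. \<forall>v\<in>power_sum z N n. f v \<in> power_sum z N n)"
    for n using power_sum_invariant[OF z T N comm] by (simp add: invariant_subspace_def)
  note sub = subspaceD[OF conjunct1[OF inv]]
  note zE = endomorphismD[OF z]
  note zn = endomorphismD[OF endomorphism_funpow[OF z]]
  have zn0: "(z ^^ n) \<zero>\<^bsub>V\<^esub> = \<zero>\<^bsub>V\<^esub>" for n
    by (rule endomorphism_zero[OF endomorphism_funpow[OF z]])
  have Xmono: "X m \<subseteq> X n" if "m \<le> n" for m n
    using lift_Suc_mono_le[of X, OF XD(4) that] .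
  \<comment> \<open>The leading coefficients of the elements of \<open>X k\<close> that are polynomials of degree \<open>n\<close> in \<open>z\<close>.\<close>
  define lc where "lc n k = {v \<in> N. \<exists>a\<in>power_sum z N n. a \<oplus>\<^bsub>V\<^esub> (z ^^ n) v \<in> X k}" for n k
  have lc_inv: "invariant_subspace T (lc n k)" for n k
    unfolding invariant_subspace_def
  proof (intro conjI ballI)
    show "VectorSpace.subspace K (lc n k) V"
    proof (rule subspaceI)
      show "lc n k \<subseteq> carrier V" using ND(1) by (auto simp: lc_def)
      show "\<zero>\<^bsub>V\<^esub> \<in> lc n k"
        unfolding lc_def using ND(2) sub(2)[of n] Xsub(2)[of k] zn0[of n] by force
      show "u \<oplus>\<^bsub>V\<^esub> v \<in> lc n k" if "u \<in> lc n k" "v \<in> lc n k" for u v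
      proof -
        from that obtain a b where *: "u \<in> N" "v \<in> N" "a \<in> power_sum z N n" "b \<in> power_sum z N n"
          "a \<oplus>\<^bsub>V\<^esub> (z ^^ n) u \<in> X k" "b \<oplus>\<^bsub>V\<^esub> (z ^^ n) v \<in> X k" by (auto simp: lc_def)
        have "(a \<oplus>\<^bsub>V\<^esub> b) \<oplus>\<^bsub>V\<^esub> (z ^^ n) (u \<oplus>\<^bsub>V\<^esub> v)
            = (a \<oplus>\<^bsub>V\<^esub> (z ^^ n) u) \<oplus>\<^bsub>V\<^esub> (b \<oplus>\<^bsub>V\<^esub> (z ^^ n) v)"
          using * ND(1) sub(1) zn(1,2) by (simp add: M.a_ac)
        then have "(a \<oplus>\<^bsub>V\<^esub> b) \<oplus>\<^bsub>V\<^esub> (z ^^ n) (u \<oplus>\<^bsub>V\<^esub> v) \<in> X k"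
          using Xsub(3)[OF *(5,6)] by simp
        then show ?thesis
          unfolding lc_def using ND(3)[OF *(1,2)] sub(3)[OF *(3,4)] by blast
      qed
      show "c \<odot>\<^bsub>V\<^esub> u \<in> lc n k" if c: "c \<in> carrier K" and "u \<in> lc n k" for c u
      proof -
        from that obtain a where *: "u \<in> N" "a \<in> power_sum z N n" "a \<oplus>\<^bsub>V\<^esub> (z ^^ n) u \<in> X k"
          by (auto simp: lc_def)
        have "c \<odot>\<^bsub>V\<^esub> a \<oplus>\<^bsub>V\<^esub> (z ^^ n) (c \<odot>\<^bsub>V\<^esub> u) = c \<odot>\<^bsub>V\<^esub> (a \<oplus>\<^bsub>V\<^esub> (z ^^ n) u)"
          using * ND(1) sub(1) zn(1,3) c by (simp add: smult_r_distr)
        then have "c \<odot>\<^bsub>V\<^esub> a \<oplus>\<^bsub>V\<^esub> (z ^^ n) (c \<odot>\<^bsub>V\<^esub> u) \<in> X k"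
          using Xsub(4)[OF c *(3)] by simp
        then show ?thesis
          unfolding lc_def using ND(4)[OF c *(1)] sub(4)[OF c *(2)] by blast
      qed
    qed
    show "f u \<in> lc n k" if f: "f \<in> T" and u: "u \<in> lc n k" for f u
    proof -
      from u obtain a where *: "u \<in> N" "a \<in> power_sum z N n" "a \<oplus>\<^bsub>V\<^esub> (z ^^ n) u \<in> X k"
        by (auto simp: lc_def)
      have fE: "f \<in> endomorphisms" using f T by blast
      have "f ((z ^^ n) u) = (z ^^ n) (f u)"
        using funpow_commute[of z f u n] zE(1) endomorphismD(1)[OF fE] comm[OF f]
          ND(1)[OF *(1)] by simp
      then have "f a \<oplus>\<^bsub>V\<^esub> (z ^^ n) (f u) = f (a \<oplus>\<^bsub>V\<^esub> (z ^^ n) u)"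
        using * ND(1) sub(1) zn(1) endomorphismD(2)[OF fE] by simp
      then have "f a \<oplus>\<^bsub>V\<^esub> (z ^^ n) (f u) \<in> X k" using XD(2)[OF _ *(3)] f by simp
      moreover have "f a \<in> power_sum z N n" "f u \<in> N" using * f NT inv by auto
      ultimately show ?thesis unfolding lc_def by blast
    qed
  qed
  have lc_mono1: "lc n k \<subseteq> lc (Suc n) k" for n k
  proof
    fix v assume "v \<in> lc n k"
    then obtain a where *: "v \<in> N" "a \<in> power_sum z N n" "a \<oplus>\<^bsub>V\<^esub> (z ^^ n) v \<in> X k"
      by (auto simp: lc_def)
    have "z a \<oplus>\<^bsub>V\<^esub> (z ^^ Suc n) v = z (a \<oplus>\<^bsub>V\<^esub> (z ^^ n) v)"
      using * ND(1) sub(1) zn(1) zE(2) by simp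
    then have "z a \<oplus>\<^bsub>V\<^esub> (z ^^ Suc n) v \<in> X k" using XD(2)[OF _ *(3)] by simp
    then show "v \<in> lc (Suc n) k"
      unfolding lc_def using *(1) power_sum_shift[OF z NV *(2)] by blast
  qed
  have lc_mono2: "lc n k \<subseteq> lc n (Suc k)" for n k
    unfolding lc_def using XD(4)[of k] by blast
  have lcN: "lc n k \<subseteq> N" for n k by (auto simp: lc_def)
  have "\<exists>m. \<forall>n. \<forall>k\<ge>m. lc n k = lc n m"
  proof (rule double_chain_stable[of lc, OF lc_mono1 lc_mono2])
    show "\<exists>m. \<forall>k\<ge>m. lc n k = lc n m" for n
      by (rule noetherian_underD[of T N "lc n", OF noeth lc_inv lcN lc_mono2])
    show "\<exists>m. \<forall>k\<ge>m. lc k k = lc m m"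
      by (rule noetherian_underD[of T N "\<lambda>k. lc k k", OF noeth lc_inv lcN subset_trans[OF lc_mono1 lc_mono2]])
  qed
  then obtain m where m: "\<And>n k. m \<le> k \<Longrightarrow> lc n k = lc n m" by blast
  have "X k \<subseteq> X m" if k: "m \<le> k" for k
  proof -
    have "y \<in> X m" if "y \<in> power_sum z N n" "y \<in> X k" for n y
      using that
    proof (induction n arbitrary: y)
      case 0
      then show ?case using Xsub(2) by simp
    next
      case (Suc n)
      from Suc.prems(1) obtain a v where *: "a \<in> power_sum z N n" "v \<in> N"
        "y = a \<oplus>\<^bsub>V\<^esub> (z ^^ n) v" by auto
      then have "v \<in> lc n k" using Suc.prems(2) by (auto simp: lc_def)
      then have "v \<in> lc n m" using m[OF k] by simp
      then obtain a' where a': "a' \<in> power_sum z N n" "a' \<oplus>\<^bsub>V\<^esub> (z ^^ n) v \<in> X m"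
        by (auto simp: lc_def)
      \<comment> \<open>Subtracting an element of \<open>X m\<close> with the same leading coefficient lowers the degree.\<close>
      let ?x = "a' \<oplus>\<^bsub>V\<^esub> (z ^^ n) v"
      have c: "a \<in> carrier V" "a' \<in> carrier V" "(z ^^ n) v \<in> carrier V"
        using * a' sub(1) ND(1) zn(1) by auto
      have "y \<oplus>\<^bsub>V\<^esub> \<ominus>\<^bsub>V\<^esub> ?x = (a \<oplus>\<^bsub>V\<^esub> \<ominus>\<^bsub>V\<^esub> a') \<oplus>\<^bsub>V\<^esub> ((z ^^ n) v \<oplus>\<^bsub>V\<^esub> \<ominus>\<^bsub>V\<^esub> ((z ^^ n) v))"
        using c unfolding *(3) by (simp only: M.minus_add M.a_ac M.a_closed M.a_inv_closed)
      then have eq: "y \<ominus>\<^bsub>V\<^esub> ?x = a \<ominus>\<^bsub>V\<^esub> a'"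
        using c by (simp add: a_minus_def M.r_neg)
      have "y \<ominus>\<^bsub>V\<^esub> ?x \<in> X m"
      proof (rule Suc.IH)
        show "y \<ominus>\<^bsub>V\<^esub> ?x \<in> power_sum z N n"
          unfolding eq using subspace_minus[OF conjunct1[OF inv]] *(1) a'(1) by blast
        show "y \<ominus>\<^bsub>V\<^esub> ?x \<in> X k"
          using subspace_minus[OF XD(1) Suc.prems(2)] a'(2) Xmono[OF k] by blast
      qed
      then have "y \<oplus>\<^bsub>V\<^esub> \<ominus>\<^bsub>V\<^esub> ?x \<in> X m" by (simp add: a_minus_def)
      moreover have "\<ominus>\<^bsub>V\<^esub> ?x \<in> X m" using subspace_uminus[OF XD(1) a'(2)] .
      moreover have "y \<in> carrier V" using Xsub(1)[OF Suc.prems(2)] .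
      ultimately show ?case by (rule subspace_cancel_right[OF XD(1)])
    qed
    then show ?thesis using XD(3)[of k] by blast
  qed
  then show "\<exists>n. \<forall>k\<ge>n. X k = X n" using Xmono by blast
qed

lemma invariant_hull_noetherian:
  assumes "finite Z" and Z: "Z \<subseteq> endomorphisms"
    and comm: "\<And>f g v. \<lbrakk>f \<in> Z; g \<in> Z; v \<in> carrier V\<rbrakk> \<Longrightarrow> f (g v) = g (f v)"
    and N: "VectorSpace.subspace K N V" "finitely_spanned N"
  shows "\<exists>H. invariant_subspace Z H \<and> N \<subseteq> H \<and> noetherian_under Z H"
  using assms(1) Z comm
proof (induction rule: finite_induct)
  case empty
  then show ?case
    using N finitely_spanned_noetherian[of N "{}"] by (auto simp: invariant_subspace_def)
next
  case (insert z Z)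
  then obtain H where H: "invariant_subspace Z H" "N \<subseteq> H" "noetherian_under Z H" by auto
  have zZ: "z \<in> endomorphisms" "Z \<subseteq> endomorphisms"
    "\<And>f v. \<lbrakk>f \<in> Z; v \<in> carrier V\<rbrakk> \<Longrightarrow> f (z v) = z (f v)"
    using insert.prems by auto
  have "H \<subseteq> power_sum z H (Suc 0)" using H(1) power_sum_1 by (simp add: invariant_subspace_def)
  then have "N \<subseteq> (\<Union>n. power_sum z H n)" using H(2) by blast
  then show ?case
    using power_sum_Union_invariant[OF zZ(1,2) H(1) zZ(3)] hilbert_basis_step[OF zZ(1,2) H(1) zZ(3) H(3)]
    by blast
qed

text \<open>
  The finite-dimensional counterpart: if all operators are nilpotent on an invariant space around
  \<open>N\<close>, then finitely many monomials in them, applied to \<open>N\<close>, span an invariant space.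
\<close>

lemma invariant_hull_nilpotent:
  assumes "finite Z" and Z: "Z \<subseteq> endomorphisms"
    and comm: "\<And>f g v. \<lbrakk>f \<in> Z; g \<in> Z; v \<in> carrier V\<rbrakk> \<Longrightarrow> f (g v) = g (f v)"
    and N: "VectorSpace.subspace K N V" "finitely_spanned N" "N \<subseteq> U"
    and U: "invariant_subspace Z U"
    and nil: "\<And>z. z \<in> Z \<Longrightarrow> \<exists>m. \<forall>v\<in>U. (z ^^ m) v = \<zero>\<^bsub>V\<^esub>"
  shows "\<exists>H. invariant_subspace Z H \<and> N \<subseteq> H \<and> H \<subseteq> U \<and> finitely_spanned H"
  using assms(1) Z comm U nil
proof (induction rule: finite_induct)
  case empty
  then show ?case using N by (auto simp: invariant_subspace_def)
next
  case (insert z Z)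
  have "invariant_subspace Z U" using insert.prems(3) by (simp add: invariant_subspace_def)
  with insert obtain H where H: "invariant_subspace Z H" "N \<subseteq> H" "H \<subseteq> U" "finitely_spanned H"
    by auto
  have z: "z \<in> endomorphisms" using insert.prems by auto
  have HV: "VectorSpace.subspace K H V" using H(1) by (simp add: invariant_subspace_def)
  have UV: "VectorSpace.subspace K U V" and Uz: "\<And>v. v \<in> U \<Longrightarrow> z v \<in> U"
    using insert.prems(3) by (auto simp: invariant_subspace_def)
  obtain m where m: "\<And>v. v \<in> U \<Longrightarrow> (z ^^ m) v = \<zero>\<^bsub>V\<^esub>" using insert.prems(4) by blast
  have m': "(z ^^ Suc m) v = \<zero>\<^bsub>V\<^esub>" if "v \<in> U" for v
    using m[OF that] endomorphism_zero[OF z] by simp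
  let ?H = "power_sum z H (Suc m)"
  have inv: "invariant_subspace Z ?H"
    by (rule power_sum_invariant[OF z _ H(1)]) (use insert.prems in auto)
  have Hc: "power_sum z H n \<subseteq> carrier V" for n
    using power_sum_invariant[OF z _ H(1), of n] insert.prems subspaceD(1)
    by (auto simp: invariant_subspace_def)
  have "z v \<in> ?H" if v: "v \<in> ?H" for v
  proof -
    from power_sum_shift[OF z HV v] obtain a b where *: "a \<in> ?H" "b \<in> H"
      "z v = a \<oplus>\<^bsub>V\<^esub> (z ^^ Suc m) b" unfolding power_sum.simps(2)[of z H "Suc m"] by blast
    have "b \<in> U" "a \<in> carrier V" using *(1,2) H(3) Hc[of "Suc m"] by blast+
    then have "z v = a" using *(3) m'[of b] by (simp del: funpow.simps)
    then show ?thesis using *(1) by (simp only:)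
  qed
  then have "invariant_subspace (insert z Z) ?H" using inv by (auto simp: invariant_subspace_def)
  moreover have "power_sum z H n \<subseteq> U" for n
  proof (induction n)
    case 0
    then show ?case using subspaceD(2)[OF UV] by simp
  next
    case (Suc n)
    have "(z ^^ n) v \<in> U" if "v \<in> U" for v using that by (induction n) (auto simp: Uz)
    then have "a \<oplus>\<^bsub>V\<^esub> (z ^^ n) v \<in> U" if "a \<in> power_sum z H n" "v \<in> H" for a v
      using that Suc H(3) subspaceD(3)[OF UV] by blast
    then show ?case by auto
  qed
  moreover have "N \<subseteq> ?H"
  proof -
    have "power_sum z H (Suc 0) \<subseteq> ?H"
      by (rule lift_Suc_mono_le[of "power_sum z H", OF power_sum_mono_Suc[OF z HV]]) simp
    then show ?thesis using power_sum_1[OF HV, of z] H(2) by blast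
  qed
  moreover have "finitely_spanned ?H" by (rule power_sum_finitely_spanned[OF z H(4)])
  ultimately show ?case by blast
qed

end

section \<open>Derivations in prime characteristic\<close>

lemma (in vectorspace) add_pow_characteristic:
  assumes "v \<in> carrier V"
  shows "add_pow V (characteristic K) v = \<zero>\<^bsub>V\<^esub>"
proof -
  have *: "add_pow V n v = add_pow K n \<one>\<^bsub>K\<^esub> \<odot>\<^bsub>V\<^esub> v" for n :: nat
    by (induction n) (use assms in \<open>auto simp: smult_l_distr\<close>)
  have "add_pow K (characteristic K) \<one>\<^bsub>K\<^esub> = \<zero>\<^bsub>K\<^esub>"
    using group.pow_ord_eq_1[OF R.a_group, of "\<one>\<^bsub>K\<^esub>"] by (simp add: characteristic_def add_pow_def)
  then show ?thesis using * assms by simp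
qed

text \<open>
  The binomial formula for \<open>n\<close> applications of a product rule: \<open>t i j\<close> stands for the term in which
  one factor has been differentiated \<open>i\<close> times and the other \<open>j\<close> times.
\<close>

lemma (in vectorspace) funpow_pascal:
  assumes f: "\<And>v. v \<in> carrier V \<Longrightarrow> f v \<in> carrier V"
      "\<And>u v. \<lbrakk>u \<in> carrier V; v \<in> carrier V\<rbrakk> \<Longrightarrow> f (u \<oplus>\<^bsub>V\<^esub> v) = f u \<oplus>\<^bsub>V\<^esub> f v"
    and t: "\<And>i j. t i j \<in> carrier V" "\<And>i j. f (t i j) = t i (Suc j) \<oplus>\<^bsub>V\<^esub> t (Suc i) j"
  shows "(f ^^ n) (t i j) = (\<Oplus>\<^bsub>V\<^esub>k\<in>{..n}. add_pow V (n choose k) (t (i + k) (j + (n - k))))"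
proof (induction n arbitrary: i j)
  case 0
  then show ?case using t(1) by simp
next
  case (Suc n)
  let ?p = "\<lambda>m. add_pow V (m::nat)"
  have fn: "(f ^^ n) v \<in> carrier V" if "v \<in> carrier V" for v
    using that by (induction n) (auto simp: f(1))
  have fn_add: "(f ^^ n) (u \<oplus>\<^bsub>V\<^esub> v) = (f ^^ n) u \<oplus>\<^bsub>V\<^esub> (f ^^ n) v"
    if uv: "u \<in> carrier V" "v \<in> carrier V" for u v
  proof (induction n)
    case (Suc n)
    have "(f ^^ n) w \<in> carrier V" if "w \<in> carrier V" for w
      using that by (induction n) (auto simp: f(1))
    then show ?case using Suc uv f(2) by simp
  qed simp
  have pc: "?p m (t a b) \<in> carrier V" for m a b using t(1) by simp
  let ?g = "\<lambda>k. ?p (n choose k) (t (i + k) (j + (Suc n - k)))"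
  let ?h = "\<lambda>k. case k of 0 \<Rightarrow> \<zero>\<^bsub>V\<^esub> | Suc l \<Rightarrow> ?p (n choose l) (t (i + Suc l) (j + (n - l)))"
  have hc: "?h k \<in> carrier V" for k by (cases k) (simp_all add: pc)
  have "(f ^^ Suc n) (t i j) = (f ^^ n) (t i (Suc j)) \<oplus>\<^bsub>V\<^esub> (f ^^ n) (t (Suc i) j)"
    unfolding funpow_Suc_right comp_def t(2) by (rule fn_add[OF t(1) t(1)])
  also have "(f ^^ n) (t i (Suc j)) = (\<Oplus>\<^bsub>V\<^esub>k\<in>{..n}. ?g k)"
    unfolding Suc.IH by (rule M.finsum_cong') (auto simp: pc Suc_diff_le)
  also have "\<dots> = (\<Oplus>\<^bsub>V\<^esub>k\<in>{..Suc n}. ?g k)"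
    by (subst M.finsum_Suc) (auto simp: pc binomial_eq_0)
  also have "(f ^^ n) (t (Suc i) j) = (\<Oplus>\<^bsub>V\<^esub>k\<in>{..Suc n}. ?h k)"
    proof -
    have "(\<Oplus>\<^bsub>V\<^esub>k\<in>{..Suc n}. ?h k) = (\<Oplus>\<^bsub>V\<^esub>k\<in>{..n}. ?h (Suc k)) \<oplus>\<^bsub>V\<^esub> ?h 0"
      by (rule M.finsum_Suc2) (simp only: Pi_def hc mem_Collect_eq simp_thms)
    moreover have "(\<Oplus>\<^bsub>V\<^esub>k\<in>{..n}. ?h (Suc k)) \<in> carrier V"
      by (rule M.finsum_closed) (simp only: Pi_def hc mem_Collect_eq simp_thms)
    ultimately show ?thesis unfolding Suc.IH by simp
  qed
  also have "(\<Oplus>\<^bsub>V\<^esub>k\<in>{..Suc n}. ?g k) \<oplus>\<^bsub>V\<^esub> (\<Oplus>\<^bsub>V\<^esub>k\<in>{..Suc n}. ?h k)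
      = (\<Oplus>\<^bsub>V\<^esub>k\<in>{..Suc n}. ?g k \<oplus>\<^bsub>V\<^esub> ?h k)"
    by (rule M.finsum_addf[symmetric]) (auto simp: pc hc)
  also have "\<dots> = (\<Oplus>\<^bsub>V\<^esub>k\<in>{..Suc n}. ?p (Suc n choose k) (t (i + k) (j + (Suc n - k))))"
  proof (rule M.finsum_cong')
    show "?g k \<oplus>\<^bsub>V\<^esub> ?h k = ?p (Suc n choose k) (t (i + k) (j + (Suc n - k)))" for k
      by (cases k) (simp_all add: t(1) M.add.nat_pow_mult M.a_comm del: M.add.nat_pow_Suc)
  qed (auto simp: pc)
  finally show ?case .
qed

text \<open>
  In characteristic \<open>p\<close> the inner binomial coefficients of the \<open>p\<close>-th power vanish, so the \<open>p\<close>-th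
  power of a derivation is again a derivation.
\<close>

lemma (in vectorspace) funpow_prime_characteristic:
  assumes p: "Factorial_Ring.prime (characteristic K)"
    and f: "\<And>v. v \<in> carrier V \<Longrightarrow> f v \<in> carrier V"
      "\<And>u v. \<lbrakk>u \<in> carrier V; v \<in> carrier V\<rbrakk> \<Longrightarrow> f (u \<oplus>\<^bsub>V\<^esub> v) = f u \<oplus>\<^bsub>V\<^esub> f v"
    and t: "\<And>i j. t i j \<in> carrier V" "\<And>i j. f (t i j) = t i (Suc j) \<oplus>\<^bsub>V\<^esub> t (Suc i) j"
  shows "(f ^^ characteristic K) (t 0 0) = t 0 (characteristic K) \<oplus>\<^bsub>V\<^esub> t (characteristic K) 0"
proof -
  obtain q where q: "characteristic K = Suc q" using p prime_gt_0_nat gr0_implies_Suc by blast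
  let ?g = "\<lambda>k. add_pow V (Suc q choose k) (t k (Suc q - k))"
  have gc: "?g k \<in> carrier V" for k using t(1) by simp
  have g0: "?g k = (if 0 = k then t k (Suc q - k) else \<zero>\<^bsub>V\<^esub>)" if "k \<le> q" for k
  proof (cases "k = 0")
    case True
    then show ?thesis using t(1) by simp
  next
    case False
    then have "Suc q dvd (Suc q choose k)"
      using dvd_choose_prime[of k "Suc q"] p q that by auto
    then obtain m where "Suc q choose k = Suc q * m" by blast
    then have "?g k = add_pow V m (add_pow V (characteristic K) (t k (Suc q - k)))"
      using t(1) by (simp add: M.add.nat_pow_pow q del: M.add.nat_pow_Suc mult_Suc)
    then show ?thesis using False add_pow_characteristic[OF t(1)] by simp
  qed
  have "(f ^^ Suc q) (t 0 0) = (\<Oplus>\<^bsub>V\<^esub>k\<in>{..Suc q}. ?g k)"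
    using funpow_pascal[of f t "Suc q" 0 0, OF f t] by simp
  also have "\<dots> = ?g (Suc q) \<oplus>\<^bsub>V\<^esub> (\<Oplus>\<^bsub>V\<^esub>k\<in>{..q}. ?g k)"
    by (rule M.finsum_Suc) (simp add: gc Pi_def)
  also have "(\<Oplus>\<^bsub>V\<^esub>k\<in>{..q}. ?g k) = (\<Oplus>\<^bsub>V\<^esub>k\<in>{..q}. if 0 = k then t k (Suc q - k) else \<zero>\<^bsub>V\<^esub>)"
    by (rule M.finsum_cong') (use g0 t(1) in auto)
  also have "\<dots> = t 0 (Suc q)"
    using M.finsum_singleton[of 0 "{..q}" "\<lambda>k. t k (Suc q - k)"] t(1) by simp
  also have "?g (Suc q) = t (Suc q) 0" using t(1) by simp
  finally show ?thesis using t(1) M.a_comm by (simp add: q)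
qed

context lie_module
begin

abbreviation lie_endomorphisms where
  "lie_endomorphisms \<equiv> LinearCombinations.module_hom K L L"

text \<open>
  The pairs \<open>(q(act x), q(ad x))\<close> for the p-polynomials \<open>q = \<Sum> c\<^sub>i t^(p^i)\<close>, where \<open>ad x\<close> is the
  bracket with \<open>x\<close>.  They are generated as pairs, without reference to the coefficients of \<open>q\<close>,
  since the two components are always used together in the product rule of lemma
  \<open>p_polynomial_leibniz\<close>.
\<close>

inductive p_polynomial for x where
  self: "p_polynomial x (act M x) (bracket L x)"
| add: "\<lbrakk>p_polynomial x P D; p_polynomial x Q C\<rbrakk>
    \<Longrightarrow> p_polynomial x (\<lambda>v. P v \<oplus> Q v) (\<lambda>y. D y \<oplus>\<^bsub>L\<^esub> C y)"
| smult: "\<lbrakk>c \<in> carrier K; p_polynomial x P D\<rbrakk>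
    \<Longrightarrow> p_polynomial x (\<lambda>v. c \<odot> P v) (\<lambda>y. c \<odot>\<^bsub>L\<^esub> D y)"
| frobenius: "p_polynomial x P D \<Longrightarrow> p_polynomial x (P ^^ characteristic K) (D ^^ characteristic K)"

lemma act_endomorphism: "x \<in> carrier L \<Longrightarrow> act M x \<in> endomorphisms"
  by (rule endomorphismI) (auto simp: act_closed act_add_right act_smult_right)

lemma bracket_endomorphism: "x \<in> carrier L \<Longrightarrow> bracket L x \<in> lie_endomorphisms"
  by (rule L.endomorphismI) (auto simp: bracket_closed bracket_add_right bracket_smult_right)

lemma p_polynomial_endomorphism:
  assumes x: "x \<in> carrier L" and "p_polynomial x P D"
  shows "P \<in> endomorphisms" "D \<in> lie_endomorphisms"
proof -
  have "P \<in> endomorphisms \<and> D \<in> lie_endomorphisms"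
    using assms(2)
  proof induction
    case self
    then show ?case using x act_endomorphism bracket_endomorphism by simp
  next
    case (add P D Q C)
    then have P: "P \<in> endomorphisms" "Q \<in> endomorphisms" and D: "D \<in> lie_endomorphisms" "C \<in> lie_endomorphisms"
      by auto
    show ?case
      using endomorphismD[OF P(1)] endomorphismD[OF P(2)] L.endomorphismD[OF D(1)] L.endomorphismD[OF D(2)]
      by (intro conjI endomorphismI L.endomorphismI)
        (simp_all add: M.a_ac L.module.M.a_ac smult_r_distr L.module.smult_r_distr)
  next
    case (smult c P D)
    then have P: "P \<in> endomorphisms" and D: "D \<in> lie_endomorphisms" by auto
    show ?case
      using endomorphismD[OF P] L.endomorphismD[OF D] smult(1)
      by (intro conjI endomorphismI L.endomorphismI)
        (simp_all add: smult_r_distr L.module.smult_r_distr smult_assoc1[symmetric] L.module.smult_assoc1[symmetric] R.m_comm)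
  next
    case (frobenius P D)
    then show ?case using endomorphism_funpow L.endomorphism_funpow by blast
  qed
  then show "P \<in> endomorphisms" "D \<in> lie_endomorphisms" by auto
qed

text \<open>
  For \<open>q = t\<close> this is the action of the bracket; the rule is linear in \<open>q\<close> and survives \<open>p\<close>-th powers
  in characteristic \<open>p\<close>.  Consequently \<open>q(act x)\<close> commutes with the action of the whole Lie
  algebra as soon as \<open>q(ad x) = 0\<close>.
\<close>

lemma p_polynomial_leibniz:
  assumes p: "Factorial_Ring.prime (characteristic K)" and x: "x \<in> carrier L" and "p_polynomial x P D"
    and "y \<in> carrier L" "v \<in> carrier M"
  shows "P (act M y v) = act M y (P v) \<oplus> act M (D y) v"
  using assms(3-5)
proof (induction arbitrary: y v)
  case self
  have "act M (bracket L x y) v = act M x (act M y v) \<ominus> act M y (act M x v)"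
    using act_bracket x self by blast
  then show ?case
    using x self by (simp add: act_closed a_minus_def M.a_ac M.r_neg)
next
  case (add P D Q C)
  note P = endomorphismD(1)[OF p_polynomial_endomorphism(1)[OF x add.hyps(1)]]
  note Q = endomorphismD(1)[OF p_polynomial_endomorphism(1)[OF x add.hyps(2)]]
  note D = L.endomorphismD(1)[OF p_polynomial_endomorphism(2)[OF x add.hyps(1)]]
  note C = L.endomorphismD(1)[OF p_polynomial_endomorphism(2)[OF x add.hyps(2)]]
  show ?case
    using add.prems
    by (simp add: add.IH P Q D C act_closed act_add_left act_add_right M.a_ac)
next
  case (smult c P D)
  note P = endomorphismD(1)[OF p_polynomial_endomorphism(1)[OF x smult.hyps(2)]]
  note D = L.endomorphismD(1)[OF p_polynomial_endomorphism(2)[OF x smult.hyps(2)]]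
  show ?case
    using smult.prems smult.hyps(1)
    by (simp add: smult.IH P D act_closed act_smult_left act_smult_right smult_r_distr)
next
  case (frobenius P D)
  note P = p_polynomial_endomorphism(1)[OF x frobenius.hyps]
  note D = p_polynomial_endomorphism(2)[OF x frobenius.hyps]
  define t where "t i j = act M ((D ^^ i) y) ((P ^^ j) v)" for i j
  have Pj: "(P ^^ j) v \<in> carrier M" for j
    using endomorphismD(1)[OF endomorphism_funpow[OF P]] frobenius.prems by blast
  have Di: "(D ^^ i) y \<in> carrier L" for i
    using L.endomorphismD(1)[OF L.endomorphism_funpow[OF D]] frobenius.prems by blast
  have "(P ^^ characteristic K) (t 0 0) = t 0 (characteristic K) \<oplus> t (characteristic K) 0"
  proof (rule funpow_prime_characteristic[OF p endomorphismD(1)[OF P] endomorphismD(2)[OF P]])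
    show "t i j \<in> carrier M" for i j by (simp add: t_def act_closed Pj Di)
    show "P (t i j) = t i (Suc j) \<oplus> t (Suc i) j" for i j
      using frobenius.IH[OF Di Pj] by (simp add: t_def)
  qed
  then show ?case by (simp add: t_def)
qed

lemma p_polynomial_submodule:
  assumes "p_polynomial x P D" "x \<in> carrier L" "lie_submodule K L N M" "v \<in> N"
  shows "P v \<in> N"
  using assms(1,4)
proof (induction arbitrary: v)
  case (frobenius P D)
  have "(P ^^ n) v \<in> N" for n by (induction n) (use frobenius in auto)
  then show ?case .
next
  case self
  then show ?case using assms(2,3) by (auto simp: lie_submodule_def)
next
  case (add P D Q C)
  then show ?case using assms(3) subspaceD(3) by (auto simp: lie_submodule_def)
next
  case (smult c P D)
  then show ?case using assms(3) subspaceD(4) by (auto simp: lie_submodule_def)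
qed

lemma p_polynomial_commute:
  assumes x: "x \<in> carrier L" and "p_polynomial x P D" and f: "f \<in> endomorphisms"
    and fx: "\<And>v. v \<in> carrier M \<Longrightarrow> f (act M x v) = act M x (f v)" and v: "v \<in> carrier M"
  shows "f (P v) = P (f v)"
  using assms(2) v
proof (induction arbitrary: v)
  case self
  then show ?case using fx by simp
next
  case (add P D Q C)
  then show ?case
    using endomorphismD(1)[OF p_polynomial_endomorphism(1)[OF x add.hyps(1)]]
      endomorphismD(1)[OF p_polynomial_endomorphism(1)[OF x add.hyps(2)]] endomorphismD(2)[OF f]
    by simp
next
  case (smult c P D)
  then show ?case
    using endomorphismD(1)[OF p_polynomial_endomorphism(1)[OF x smult.hyps(2)]] endomorphismD(3)[OF f]
    by simp
next
  case (frobenius P D)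
  show ?case
    using funpow_commute[of P f v] endomorphismD(1)[OF p_polynomial_endomorphism(1)[OF x frobenius.hyps]]
      endomorphismD(1)[OF f] frobenius.IH frobenius.prems by simp
qed

lemma p_polynomial_frobenius_power:
  assumes "p_polynomial x P D"
  shows "p_polynomial x (P ^^ (characteristic K ^ i)) (D ^^ (characteristic K ^ i))"
proof (induction i)
  case 0
  then show ?case using assms by simp
next
  case (Suc i)
  from p_polynomial.frobenius[OF this] show ?case by (simp add: funpow_mult mult.commute)
qed

end

section \<open>The word filtration\<close>

text \<open>
  A finite-dimensional Lie algebra with a finite spanning set \<open>B\<close>, which supplies the letters of the
  words, and a finite set \<open>S\<close> of module elements, which are to be shown to generate a
  finite-dimensional submodule.
\<close>

locale filtered_lie_module = lie_module K L M
  for K :: "('k, 'r) ring_scheme" and L :: "('k, 'a) lie_algebra"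
    and M :: "('k, 'a, 'm) lie_module" (structure) +
  fixes B :: "'a set" and S :: "'m set"
  assumes prime_characteristic: "Factorial_Ring.prime (characteristic K)"
    and finite_B: "finite B" and B_carrier: "B \<subseteq> carrier L" and span_B: "LinearCombinations.module.span K L B = carrier L"
    and finite_S: "finite S" and S_carrier: "S \<subseteq> carrier M"
begin

abbreviation word :: "'a list \<Rightarrow> 'm \<Rightarrow> 'm" where
  "word w s \<equiv> foldr (act M) w s"

text \<open>
  The strict bound on the length makes the filtration start with the zero space.  In this
  way the error terms of a word of length \<open>m\<close>, which are combinations of strictly shorter words, lie in
  the step with index \<open>m\<close>, also for \<open>m = 0\<close>.
\<close>

definition short_words :: "nat \<Rightarrow> 'm set" where
  "short_words m = (\<lambda>(w, s). word w s) ` ({w. set w \<subseteq> B \<and> length w < m} \<times> S)"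

definition filtration :: "nat \<Rightarrow> 'm set" where
  "filtration m = span (short_words m)"

lemma word_carrier: "\<lbrakk>set w \<subseteq> B; s \<in> S\<rbrakk> \<Longrightarrow> word w s \<in> carrier M"
  using B_carrier S_carrier by (intro word_closed) auto

lemma short_words_carrier: "short_words m \<subseteq> carrier M"
  using word_carrier by (auto simp: short_words_def)

lemma filtration_subspace: "VectorSpace.subspace K (filtration m) M"
  unfolding filtration_def by (rule span_is_subspace[OF short_words_carrier])

lemmas filtrationD = subspaceD[OF filtration_subspace]

lemma filtration_finitely_spanned: "finitely_spanned (filtration m)"
proof -
  have "{w. set w \<subseteq> B \<and> length w < m} \<subseteq> {w. set w \<subseteq> B \<and> length w \<le> m}" by auto
  then have "finite {w. set w \<subseteq> B \<and> length w < m}"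
    by (rule finite_subset[OF _ finite_lists_length_le[OF finite_B]])
  then have "finite (short_words m)" using finite_S by (simp add: short_words_def)
  then show ?thesis
    unfolding filtration_def by (rule finitely_spanned_span[OF _ short_words_carrier])
qed

lemma filtration_mono: "m \<le> n \<Longrightarrow> filtration m \<subseteq> filtration n"
  unfolding filtration_def by (rule span_is_monotone) (auto simp: short_words_def)

lemma word_in_filtration: "\<lbrakk>set w \<subseteq> B; s \<in> S; length w < m\<rbrakk> \<Longrightarrow> word w s \<in> filtration m"
  using in_own_span[OF short_words_carrier] by (force simp: filtration_def short_words_def)

lemma filtration_least:
  assumes "VectorSpace.subspace K N M"
    and "\<And>w s. \<lbrakk>set w \<subseteq> B; s \<in> S; length w < m\<rbrakk> \<Longrightarrow> word w s \<in> N"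
  shows "filtration m \<subseteq> N"
  unfolding filtration_def by (rule span_least[OF assms(1)]) (use assms(2) in \<open>auto simp: short_words_def\<close>)

lemma act_linear_in_algebra:
  assumes "v \<in> carrier M"
  shows "(\<lambda>x. act M x v) \<in> LinearCombinations.module_hom K L M"
  using assms by (auto simp: LinearCombinations.module_hom_def act_closed act_add_left act_smult_left)

lemma act_filtration:
  assumes x: "x \<in> carrier L" and v: "v \<in> filtration m"
  shows "act M x v \<in> filtration (Suc m)"
proof -
  have vs: "vectorspace K L" "vectorspace K M" by unfold_locales
  have B: "act M b u \<in> filtration (Suc m)" if b: "b \<in> B" and u: "u \<in> filtration m" for b u
  proof -
    have bL: "b \<in> carrier L" using b B_carrier by blast
    have "filtration m \<subseteq> {u \<in> carrier M. act M b u \<in> filtration (Suc m)}"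
    proof (rule filtration_least)
      show "VectorSpace.subspace K {u \<in> carrier M. act M b u \<in> filtration (Suc m)} M"
        by (rule subspace_vimage[OF vs(2,2) act_endomorphism[OF bL] filtration_subspace])
      show "word w s \<in> {u \<in> carrier M. act M b u \<in> filtration (Suc m)}"
        if "set w \<subseteq> B" "s \<in> S" "length w < m" for w s
        using word_in_filtration[of "b # w" s "Suc m"] word_carrier that b by simp
    qed
    then show ?thesis using u by blast
  qed
  have vM: "v \<in> carrier M" by (rule filtrationD(1)[OF v])
  have "LinearCombinations.module.span K L B \<subseteq> {x \<in> carrier L. act M x v \<in> filtration (Suc m)}"
    by (rule L.span_least[OF subspace_vimage[OF vs act_linear_in_algebra[OF vM] filtration_subspace]])
      (use B v B_carrier in auto)
  then show ?thesis using x span_B by blast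
qed

lemma act_power_filtration:
  assumes "x \<in> carrier L" "v \<in> filtration m"
  shows "(act M x ^^ n) v \<in> filtration (m + n)"
  by (induction n) (use assms act_filtration in auto)

lemma filtration_Union_submodule: "lie_submodule K L (\<Union>m. filtration m) M"
  unfolding lie_submodule_def
proof (intro conjI ballI)
  show "VectorSpace.subspace K (\<Union>m. filtration m) M"
  proof (rule subspaceI)
    show "(\<Union>m. filtration m) \<subseteq> carrier M" using filtrationD(1) by blast
    show "\<zero> \<in> (\<Union>m. filtration m)" using filtrationD(2) by blast
    show "u \<oplus> v \<in> (\<Union>m. filtration m)"
      if uv: "u \<in> (\<Union>m. filtration m)" "v \<in> (\<Union>m. filtration m)" for u v
    proof -
      from uv obtain m n where "u \<in> filtration m" "v \<in> filtration n" by blast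
      then have "u \<in> filtration (max m n)" "v \<in> filtration (max m n)"
        using filtration_mono[of m "max m n"] filtration_mono[of n "max m n"] by auto
      then show ?thesis using filtrationD(3) by blast
    qed
    show "c \<odot> v \<in> (\<Union>m. filtration m)" if "c \<in> carrier K" "v \<in> (\<Union>m. filtration m)" for c v
      using that filtrationD(4) by blast
  qed
  show "act M x v \<in> (\<Union>m. filtration m)" if "x \<in> carrier L" "v \<in> (\<Union>m. filtration m)" for x v
    using that act_filtration by blast
qed

lemma S_in_filtration: "S \<subseteq> (\<Union>m. filtration m)"
  using word_in_filtration[of "[]" _ 1] by auto

lemma act_swap:
  assumes "x \<in> carrier L" "y \<in> carrier L" "v \<in> carrier M"
  shows "act M x (act M y v) = act M y (act M x v) \<oplus> act M (bracket L x y) v"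
  using assms by (simp add: act_bracket act_closed a_minus_def M.a_ac M.r_neg)

text \<open>
  Modulo shorter words the letters of a word commute: exchanging two adjacent letters produces
  their bracket, which is a single element of the Lie algebra.  So any letter can be moved to the front.
\<close>

lemma word_pull_letter:
  assumes "set w \<subseteq> B" "s \<in> S" "b \<in> set w"
  shows "\<exists>f\<in>filtration (length w). word w s = act M b (word (remove1 b w) s) \<oplus> f"
  using assms
proof (induction w)
  case (Cons c u)
  have u: "set u \<subseteq> B" and c: "c \<in> carrier L" "c \<in> B" and b: "b \<in> carrier L"
    using Cons.prems B_carrier by auto
  show ?case
  proof (cases "b = c")
    case True
    then show ?thesis
      using word_carrier[OF u Cons.prems(2)] act_closed[OF c(1)] filtrationD(2)
      by (intro bexI[of _ \<zero>]) simp_all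
  next
    case False
    then have bu: "b \<in> set u" using Cons.prems by simp
    let ?q = "word (remove1 b u) s"
    have r: "set (remove1 b u) \<subseteq> B" "length (remove1 b u) < length u"
      using u set_remove1_subset[of b u] bu by (auto simp: length_remove1 dest: length_pos_if_in_set)
    from Cons.IH[OF u Cons.prems(2) bu] obtain f where
      f: "f \<in> filtration (length u)" "word u s = act M b ?q \<oplus> f" by blast
    have q: "?q \<in> carrier M" "?q \<in> filtration (length u)"
      using word_carrier[OF r(1)] word_in_filtration[OF r(1) _ r(2)] Cons.prems(2) by auto
    have fM: "f \<in> carrier M" by (rule filtrationD(1)[OF f(1)])
    have bc: "bracket L c b \<in> carrier L" using bracket_closed c b by simp
    let ?f = "act M (bracket L c b) ?q \<oplus> act M c f"
    have "word (c # u) s = act M c (act M b ?q) \<oplus> act M c f"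
      using f(2) q(1) fM c b by (simp add: act_closed act_add_right)
    also have "\<dots> = act M b (act M c ?q) \<oplus> ?f"
      using act_swap[OF c(1) b q(1)] q(1) fM c b bc by (simp add: act_closed M.a_assoc)
    finally have "word (c # u) s = act M b (word (remove1 b (c # u)) s) \<oplus> ?f"
      using False by simp
    moreover have "?f \<in> filtration (length (c # u))"
      using filtrationD(3) act_filtration[OF bc q(2)] act_filtration[OF c(1) f(1)] by simp
    ultimately show ?thesis by blast
  qed
qed simp

lemma word_pull_power:
  assumes s: "s \<in> S"
  shows "\<lbrakk>set w \<subseteq> B; n \<le> count_list w b; b \<in> B\<rbrakk> \<Longrightarrow>
    \<exists>r f. set r \<subseteq> B \<and> length r + n = length w \<and> f \<in> filtration (length w)
      \<and> word w s = (act M b ^^ n) (word r s) \<oplus> f"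
proof (induction n arbitrary: w)
  case 0
  then show ?case using word_carrier[OF _ s] filtrationD(2)
    by (intro exI[of _ w] exI[of _ \<zero>]) simp
next
  case (Suc n)
  have b: "b \<in> set w" using Suc.prems(2) by (metis count_notin not_less_eq_eq le0)
  have bL: "b \<in> carrier L" using Suc.prems(3) B_carrier by blast
  let ?w = "remove1 b w"
  have w: "set ?w \<subseteq> B" "length w = Suc (length ?w)"
    using Suc.prems(1) set_remove1_subset[of b w] b
    by (auto simp: length_remove1 dest: length_pos_if_in_set)
  have "n \<le> count_list ?w b"
    using Suc.prems(2) b by (induction w) auto
  from Suc.IH[OF w(1) this Suc.prems(3)] obtain r f where
    r: "set r \<subseteq> B" "length r + n = length ?w" "f \<in> filtration (length ?w)"
      "word ?w s = (act M b ^^ n) (word r s) \<oplus> f" by blast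
  from word_pull_letter[OF Suc.prems(1) s b] obtain g where
    g: "g \<in> filtration (length w)" "word w s = act M b (word ?w s) \<oplus> g" by blast
  have c: "f \<in> carrier M" "g \<in> carrier M" "(act M b ^^ n) (word r s) \<in> carrier M"
    using filtrationD(1) r(3) g(1)
      endomorphismD(1)[OF endomorphism_funpow[OF act_endomorphism[OF bL]]] word_carrier[OF r(1) s] by auto
  have "word w s = (act M b ^^ Suc n) (word r s) \<oplus> (act M b f \<oplus> g)"
    unfolding g(2) r(4) using c bL by (simp add: act_add_right act_closed M.a_assoc)
  moreover have "act M b f \<oplus> g \<in> filtration (length w)"
    using act_filtration[OF bL r(3)] g(1) w(2) filtrationD(3) by simp
  ultimately show ?case using r(1,2) w(2) by (metis add_Suc_right)
qed

text \<open>
  Degrees of operators with respect to the filtration: \<open>raises d P\<close> bounds the degree of \<open>P\<close> by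
  \<open>d\<close>, and \<open>monic x d P\<close> says that \<open>P\<close> has the leading term \<open>(act x)\<^sup>d\<close>.
\<close>

definition raises :: "nat \<Rightarrow> ('m \<Rightarrow> 'm) \<Rightarrow> bool" where
  "raises d P \<longleftrightarrow> (\<forall>m. \<forall>v\<in>filtration m. P v \<in> filtration (m + d))"

definition monic :: "'a \<Rightarrow> nat \<Rightarrow> ('m \<Rightarrow> 'm) \<Rightarrow> bool" where
  "monic x d P \<longleftrightarrow> d > 0 \<and>
     (\<forall>m. \<forall>v\<in>filtration m. \<exists>r\<in>filtration (m + d - 1). P v = (act M x ^^ d) v \<oplus> r)"

lemma monic_raises:
  assumes "x \<in> carrier L" "monic x d P"
  shows "raises d P"
  unfolding raises_def
proof (intro allI ballI)
  fix m v assume v: "v \<in> filtration m"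
  with assms(2) obtain r where "r \<in> filtration (m + d - 1)" "P v = (act M x ^^ d) v \<oplus> r"
    unfolding monic_def by blast
  then show "P v \<in> filtration (m + d)"
    using act_power_filtration[OF assms(1) v, of d] filtration_mono[of "m + d - 1" "m + d"]
      filtrationD(3) by auto
qed

lemma raises_mono: "\<lbrakk>raises d P; d \<le> e\<rbrakk> \<Longrightarrow> raises e P"
  unfolding raises_def using filtration_mono[of "_ + d" "_ + e"] by (meson add_le_mono order_refl subsetD)

lemma monic_act: "x \<in> carrier L \<Longrightarrow> monic x 1 (act M x)"
  unfolding monic_def using filtrationD act_closed by (auto intro!: bexI[of _ \<zero>])

lemma monic_comp:
  assumes x: "x \<in> carrier L" and P: "monic x d P" and Q: "monic x e Q" "Q \<in> endomorphisms"
  shows "monic x (e + d) (\<lambda>v. Q (P v))"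
  unfolding monic_def
proof (intro conjI allI ballI)
  show "0 < e + d" using P by (simp add: monic_def)
  fix m v assume v: "v \<in> filtration m"
  have d: "d > 0" and e: "e > 0" using P Q by (auto simp: monic_def)
  obtain r where r: "r \<in> filtration (m + d - 1)" "P v = (act M x ^^ d) v \<oplus> r"
    using P v unfolding monic_def by blast
  have Xv: "(act M x ^^ d) v \<in> filtration (m + d)" by (rule act_power_filtration[OF x v])
  obtain q where q: "q \<in> filtration (m + d + e - 1)"
    "Q ((act M x ^^ d) v) = (act M x ^^ e) ((act M x ^^ d) v) \<oplus> q"
    using Q(1) Xv unfolding monic_def by blast
  have Qr: "Q r \<in> filtration (m + d - 1 + e)"
    using monic_raises[OF x Q(1)] r(1) unfolding raises_def by blast
  have eq: "m + d - 1 + e = m + (e + d) - 1" "m + d + e - 1 = m + (e + d) - 1" using d by auto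
  have c: "(act M x ^^ d) v \<in> carrier M" "r \<in> carrier M" "q \<in> carrier M" "Q r \<in> carrier M"
    using filtrationD(1) Xv r(1) q(1) Qr by blast+
  have c': "(act M x ^^ e) ((act M x ^^ d) v) \<in> carrier M"
    using c(1) endomorphismD(1)[OF endomorphism_funpow[OF act_endomorphism[OF x]]] by blast
  have "Q (P v) = (act M x ^^ (e + d)) v \<oplus> (q \<oplus> Q r)"
    unfolding r(2) endomorphismD(2)[OF Q(2) c(1,2)] q(2) funpow_add comp_apply
    by (rule M.a_assoc[OF c' c(3,4)])
  then show "\<exists>r\<in>filtration (m + (e + d) - 1). Q (P v) = (act M x ^^ (e + d)) v \<oplus> r"
    using filtrationD(3) q(1) Qr unfolding eq by blast
qed

lemma monic_funpow:
  assumes x: "x \<in> carrier L" and P: "monic x d P" "P \<in> endomorphisms"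
  shows "monic x (d * Suc n) (P ^^ Suc n)"
proof (induction n)
  case (Suc n)
  have "monic x (d + d * Suc n) (\<lambda>v. P ((P ^^ Suc n) v))"
    by (rule monic_comp[OF x Suc.IH P])
  moreover have "(\<lambda>v. P ((P ^^ Suc n) v)) = P ^^ Suc (Suc n)" by (simp add: comp_def)
  ultimately show ?case by simp
qed (use P in simp)

lemma monic_add_lower:
  assumes x: "x \<in> carrier L" and P: "monic x d P" and Q: "raises (d - 1) Q"
  shows "monic x d (\<lambda>v. P v \<oplus> Q v)"
  unfolding monic_def
proof (intro conjI allI ballI)
  show d: "0 < d" using P by (simp add: monic_def)
  fix m v assume v: "v \<in> filtration m"
  obtain r where r: "r \<in> filtration (m + d - 1)" "P v = (act M x ^^ d) v \<oplus> r"
    using P v unfolding monic_def by blast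
  have q: "Q v \<in> filtration (m + d - 1)" using Q v d unfolding raises_def by force
  have c: "(act M x ^^ d) v \<in> carrier M" "r \<in> carrier M" "Q v \<in> carrier M"
    using filtrationD(1) act_power_filtration[OF x v, of d] r(1) q by blast+
  have "P v \<oplus> Q v = (act M x ^^ d) v \<oplus> (r \<oplus> Q v)"
    unfolding r(2) by (rule M.a_assoc[OF c])
  then show "\<exists>r\<in>filtration (m + d - 1). P v \<oplus> Q v = (act M x ^^ d) v \<oplus> r"
    using filtrationD(3)[OF r(1) q] by blast
qed

text \<open>
  The module is finitely generated over its central operators \<open>P b\<close>.  By the pigeonhole principle a
  word longer than the sum of the degrees \<open>d b\<close> contains some letter \<open>b\<close> at least \<open>d b\<close> times.  Moving
  these letters to the front and replacing their power by \<open>P b\<close> expresses the word, up to shorter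
  words, as \<open>P b\<close> applied to a shorter word.
\<close>

lemma filtration_generated:
  assumes P: "\<And>b. b \<in> B \<Longrightarrow> monic b (d b) (P b)"
    and H: "invariant_subspace (P ` B) H" and base: "filtration (Suc (sum d B)) \<subseteq> H"
  shows "filtration m \<subseteq> H"
proof (induction m)
  case 0
  show ?case using filtration_mono[of 0 "Suc (sum d B)"] base by blast
next
  case (Suc m)
  have HV: "VectorSpace.subspace K H M" and HP: "\<And>b v. \<lbrakk>b \<in> B; v \<in> H\<rbrakk> \<Longrightarrow> P b v \<in> H"
    using H by (auto simp: invariant_subspace_def)
  show ?case
  proof (rule filtration_least[OF HV])
    fix w s assume w: "set w \<subseteq> B" and s: "s \<in> S" and len: "length w < Suc m"
    show "word w s \<in> H"
    proof (cases "length w < Suc (sum d B)")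
      case True
      then show ?thesis using word_in_filtration[OF w s] base by blast
    next
      case False
      have "\<exists>b\<in>B. d b \<le> count_list w b"
      proof (rule ccontr)
        assume "\<not> (\<exists>b\<in>B. d b \<le> count_list w b)"
        then have "sum (count_list w) B \<le> sum d B" by (intro sum_mono) auto
        then show False using False sum_count_set[OF w finite_B] by simp
      qed
      then obtain b where b: "b \<in> B" "d b \<le> count_list w b" by blast
      have bL: "b \<in> carrier L" using b B_carrier by blast
      have d: "d b > 0" using P[OF b(1)] by (simp add: monic_def)
      from word_pull_power[OF s w b(2,1)] obtain r f where
        r: "set r \<subseteq> B" "length r + d b = length w" "f \<in> filtration (length w)"
          "word w s = (act M b ^^ d b) (word r s) \<oplus> f" by blast
      have rF: "word r s \<in> filtration (Suc (length r))" using word_in_filtration[OF r(1) s] by simp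
      obtain g where g: "g \<in> filtration (Suc (length r) + d b - 1)"
        "P b (word r s) = (act M b ^^ d b) (word r s) \<oplus> g"
        using P[OF b(1)] rF unfolding monic_def by blast
      have IH: "filtration n \<subseteq> H" if "n \<le> length w" for n
        using filtration_mono[of n m] Suc.IH len that by auto
      have gH: "g \<in> H" using g(1) r(2) IH[of "length w"] by auto
      have fH: "f \<in> H" using r(3) IH[of "length w"] by auto
      have "word r s \<in> H" using rF IH[of "Suc (length r)"] r(2) d by auto
      then have "(act M b ^^ d b) (word r s) \<oplus> g \<in> H" using HP[OF b(1)] g(2) by metis
      moreover have "(act M b ^^ d b) (word r s) \<in> carrier M"
        using endomorphismD(1)[OF endomorphism_funpow[OF act_endomorphism[OF bL]]]
          word_carrier[OF r(1) s] by blast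
      ultimately have "(act M b ^^ d b) (word r s) \<in> H" using subspace_cancel_right[OF HV _ gH] by blast
      then show ?thesis unfolding r(4) using subspaceD(3)[OF HV _ fH] by blast
    qed
  qed
qed

end

section \<open>Central p-polynomials\<close>

context filtered_lie_module
begin

text \<open>
  From a monic p-polynomial \<open>q\<close> another one is made whose value under a linear map \<open>ev\<close> into a
  finite-dimensional space is zero: the values of \<open>q, q^p, q^(p^2), \<dots>\<close> are linearly dependent, so
  some \<open>q^(p^n)\<close> minus a combination of its predecessors is mapped to zero, and it is still monic
  because the predecessors have smaller degree.  Everything that \<open>q\<close> annihilates remains annihilated,
  so that the construction can be repeated for finitely many maps.  It is used with
  \<open>ev q = q(ad x) y\<close> for \<open>y\<close> in the Lie algebra and with \<open>ev q = q(act x) w\<close> for \<open>w\<close> in a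
  finite-dimensional submodule.
\<close>

lemma p_polynomial_annihilate:
  fixes ev :: "('m \<Rightarrow> 'm) \<Rightarrow> ('a \<Rightarrow> 'a) \<Rightarrow> 'u"
  assumes x: "x \<in> carrier L" and PD: "p_polynomial x P D" "monic x d P"
    and U: "vectorspace K U" and N: "N \<subseteq> carrier U" "vectorspace.finitely_spanned K U N"
    and ev: "\<And>P D. p_polynomial x P D \<Longrightarrow> ev P D \<in> N"
    and ev_add: "\<And>P D Q C. \<lbrakk>p_polynomial x P D; p_polynomial x Q C\<rbrakk>
      \<Longrightarrow> ev (\<lambda>v. P v \<oplus> Q v) (\<lambda>y. D y \<oplus>\<^bsub>L\<^esub> C y) = ev P D \<oplus>\<^bsub>U\<^esub> ev Q C"
    and ev_smult: "\<And>c P D. \<lbrakk>c \<in> carrier K; p_polynomial x P D\<rbrakk>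
      \<Longrightarrow> ev (\<lambda>v. c \<odot> P v) (\<lambda>y. c \<odot>\<^bsub>L\<^esub> D y) = c \<odot>\<^bsub>U\<^esub> ev P D"
  shows "\<exists>P' D' d'. p_polynomial x P' D' \<and> monic x d' P' \<and> ev P' D' = \<zero>\<^bsub>U\<^esub>
    \<and> (\<forall>v\<in>carrier M. P v = \<zero> \<longrightarrow> P' v = \<zero>)
    \<and> (\<forall>y\<in>carrier L. D y = \<zero>\<^bsub>L\<^esub> \<longrightarrow> D' y = \<zero>\<^bsub>L\<^esub>)"
proof -
  interpret U: vectorspace K U by (fact U)
  let ?p = "characteristic K"
  have p: "?p > 0" using prime_characteristic prime_gt_0_nat by blast
  have d: "d > 0" using PD(2) by (simp add: monic_def)
  have PE: "P \<in> endomorphisms" and DE: "D \<in> lie_endomorphisms"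
    using p_polynomial_endomorphism[OF x PD(1)] by auto
  define Pi Di where "Pi i = P ^^ (?p ^ i)" and "Di i = D ^^ (?p ^ i)" for i
  have pp: "p_polynomial x (Pi i) (Di i)" for i
    unfolding Pi_def Di_def by (rule p_polynomial_frobenius_power[OF PD(1)])
  have mon: "monic x (d * ?p ^ i) (Pi i)" for i
  proof -
    obtain j where "?p ^ i = Suc j" using p by (metis gr0_implies_Suc zero_less_power)
    then show ?thesis using monic_funpow[OF x PD(2) PE, of j] by (simp add: Pi_def)
  qed
  have ker: "Pi i v = \<zero>" if v: "v \<in> carrier M" "P v = \<zero>" for i v
  proof -
    have "(P ^^ Suc j) v = \<zero>" for j
      by (induction j) (use v endomorphism_zero[OF PE] in auto)
    then show ?thesis unfolding Pi_def using p by (metis gr0_implies_Suc zero_less_power)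
  qed
  have kerD: "Di i y = \<zero>\<^bsub>L\<^esub>" if y: "y \<in> carrier L" "D y = \<zero>\<^bsub>L\<^esub>" for i y
  proof -
    have "(D ^^ Suc j) y = \<zero>\<^bsub>L\<^esub>" for j
      by (induction j) (use y L.endomorphism_zero[OF DE] in auto)
    then show ?thesis unfolding Di_def using p by (metis gr0_implies_Suc zero_less_power)
  qed
  obtain n where n: "ev (Pi n) (Di n) \<in> U.span ((\<lambda>i. ev (Pi i) (Di i)) ` {..<n})"
    using U.sequence_dependent[of "\<lambda>i. ev (Pi i) (Di i)" N] ev[OF pp] N by blast
  let ?e = "d * ?p ^ n - 1"
  \<comment> \<open>The p-polynomials of smaller degree that annihilate all that the given one annihilates.\<close>
  define low where "low Q C \<longleftrightarrow> p_polynomial x Q C \<and> raises ?e Q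
    \<and> (\<forall>v\<in>carrier M. P v = \<zero> \<longrightarrow> Q v = \<zero>) \<and> (\<forall>y\<in>carrier L. D y = \<zero>\<^bsub>L\<^esub> \<longrightarrow> C y = \<zero>\<^bsub>L\<^esub>)"
    for Q C
  have low_add: "low (\<lambda>v. Q v \<oplus> Q' v) (\<lambda>y. C y \<oplus>\<^bsub>L\<^esub> C' y)" if "low Q C" "low Q' C'" for Q C Q' C'
    unfolding low_def
  proof (intro conjI)
    show "p_polynomial x (\<lambda>v. Q v \<oplus> Q' v) (\<lambda>y. C y \<oplus>\<^bsub>L\<^esub> C' y)"
      using that by (intro p_polynomial.add) (simp_all add: low_def)
  qed (use that filtrationD(3) in \<open>auto simp: low_def raises_def\<close>)
  have low_smult: "low (\<lambda>v. c \<odot> Q v) (\<lambda>y. c \<odot>\<^bsub>L\<^esub> C y)" if "c \<in> carrier K" "low Q C" for c Q C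
    unfolding low_def
  proof (intro conjI)
    show "p_polynomial x (\<lambda>v. c \<odot> Q v) (\<lambda>y. c \<odot>\<^bsub>L\<^esub> C y)"
      using that by (intro p_polynomial.smult) (simp_all add: low_def)
  qed (use that filtrationD(4) in \<open>auto simp: low_def raises_def\<close>)
  have low_Pi: "low (Pi i) (Di i)" if "i < n" for i
  proof -
    have "?p ^ i < ?p ^ n"
      using that prime_gt_1_nat[OF prime_characteristic] by (rule power_strict_increasing)
    then have "d * ?p ^ i < d * ?p ^ n" using d by simp
    then have "d * ?p ^ i \<le> ?e" by linarith
    then have "raises ?e (Pi i)" using raises_mono[OF monic_raises[OF x mon]] by blast
    then show ?thesis unfolding low_def using pp ker kerD by blast
  qed
  \<comment> \<open>The zero combination has to be obtained from \<open>Pi n\<close> because there may be no \<open>i < n\<close>.\<close>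
  have low_zero: "low (\<lambda>v. \<zero>\<^bsub>K\<^esub> \<odot> Pi n v) (\<lambda>y. \<zero>\<^bsub>K\<^esub> \<odot>\<^bsub>L\<^esub> Di n y)"
  proof -
    have "Pi n v \<in> carrier M" if "v \<in> carrier M" for v
      using endomorphismD(1)[OF p_polynomial_endomorphism(1)[OF x pp]] that .
    moreover have "Di n y \<in> carrier L" if "y \<in> carrier L" for y
      using L.endomorphismD(1)[OF p_polynomial_endomorphism(2)[OF x pp]] that .
    ultimately show ?thesis
      unfolding low_def raises_def
      using p_polynomial.smult[OF _ pp[of n], of "\<zero>\<^bsub>K\<^esub>"] filtrationD(1,2) by simp
  qed
  have "VectorSpace.subspace K {ev Q C | Q C. low Q C} U"
  proof (rule U.subspaceI)
    show "{ev Q C | Q C. low Q C} \<subseteq> carrier U" using ev N(1) by (auto simp: low_def)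
    have "ev (\<lambda>v. \<zero>\<^bsub>K\<^esub> \<odot> Pi n v) (\<lambda>y. \<zero>\<^bsub>K\<^esub> \<odot>\<^bsub>L\<^esub> Di n y) = \<zero>\<^bsub>U\<^esub>"
      using ev_smult[OF _ pp[of n], of "\<zero>\<^bsub>K\<^esub>"] ev[OF pp[of n]] N(1) by auto
    then show "\<zero>\<^bsub>U\<^esub> \<in> {ev Q C | Q C. low Q C}" using low_zero by force
    show "u \<oplus>\<^bsub>U\<^esub> w \<in> {ev Q C | Q C. low Q C}"
      if uw: "u \<in> {ev Q C | Q C. low Q C}" "w \<in> {ev Q C | Q C. low Q C}" for u w
    proof -
      from uw obtain Q C Q' C' where *: "u = ev Q C" "w = ev Q' C'" "low Q C" "low Q' C'" by blast
      then have "u \<oplus>\<^bsub>U\<^esub> w = ev (\<lambda>v. Q v \<oplus> Q' v) (\<lambda>y. C y \<oplus>\<^bsub>L\<^esub> C' y)"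
        using ev_add[of Q C Q' C'] by (simp add: low_def)
      then show ?thesis using low_add[OF *(3,4)] by blast
    qed
    show "c \<odot>\<^bsub>U\<^esub> u \<in> {ev Q C | Q C. low Q C}"
      if c: "c \<in> carrier K" and "u \<in> {ev Q C | Q C. low Q C}" for c u
    proof -
      from that obtain Q C where *: "u = ev Q C" "low Q C" by blast
      then have "c \<odot>\<^bsub>U\<^esub> u = ev (\<lambda>v. c \<odot> Q v) (\<lambda>y. c \<odot>\<^bsub>L\<^esub> C y)"
        using ev_smult[OF c, of Q C] by (simp add: low_def)
      then show ?thesis using low_smult[OF c *(2)] by blast
    qed
  qed
  then have "U.span ((\<lambda>i. ev (Pi i) (Di i)) ` {..<n}) \<subseteq> {ev Q C | Q C. low Q C}"
    by (rule U.span_least) (use low_Pi in blast)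
  then obtain Q C where QC: "low Q C" "ev (Pi n) (Di n) = ev Q C" using n by blast
  let ?m = "\<ominus>\<^bsub>K\<^esub> \<one>\<^bsub>K\<^esub>"
  let ?Q = "\<lambda>v. ?m \<odot> Q v" and ?C = "\<lambda>y. ?m \<odot>\<^bsub>L\<^esub> C y"
  have m: "?m \<in> carrier K" by simp
  have QC': "low ?Q ?C" by (rule low_smult[OF m QC(1)])
  let ?P' = "\<lambda>v. Pi n v \<oplus> ?Q v" and ?D' = "\<lambda>y. Di n y \<oplus>\<^bsub>L\<^esub> ?C y"
  have "p_polynomial x ?P' ?D'"
    using QC' by (intro p_polynomial.add pp) (simp add: low_def)
  moreover have "monic x (d * ?p ^ n) ?P'"
    using QC' by (intro monic_add_lower[OF x mon]) (simp add: low_def)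
  moreover have "ev ?P' ?D' = \<zero>\<^bsub>U\<^esub>"
  proof -
    have c: "ev Q C \<in> carrier U" using QC(1) ev N(1) by (auto simp: low_def)
    have "ev ?P' ?D' = ev (Pi n) (Di n) \<oplus>\<^bsub>U\<^esub> ev ?Q ?C"
      using QC' by (intro ev_add pp) (simp add: low_def)
    also have "ev ?Q ?C = \<ominus>\<^bsub>U\<^esub> ev Q C"
      using ev_smult[OF m, of Q C] QC(1) U.smult_minus_1[OF c] by (simp add: low_def)
    finally show ?thesis using QC(2) c by (simp add: U.M.r_neg)
  qed
  moreover have "\<forall>v\<in>carrier M. P v = \<zero> \<longrightarrow> ?P' v = \<zero>"
    using QC' ker by (simp add: low_def)
  moreover have "\<forall>y\<in>carrier L. D y = \<zero>\<^bsub>L\<^esub> \<longrightarrow> ?D' y = \<zero>\<^bsub>L\<^esub>"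
    using QC' kerD by (simp add: low_def)
  ultimately show ?thesis by blast
qed

lemma finite_dimensional_algebra: "L.finitely_spanned (carrier L)"
  unfolding L.finitely_spanned_def using finite_B B_carrier span_B by blast

text \<open>
  Successive annihilation of \<open>q(ad x)\<close> on a finite spanning set of the Lie algebra.
\<close>

lemma central_p_polynomial:
  assumes x: "x \<in> carrier L"
  shows "\<exists>P D d. p_polynomial x P D \<and> monic x d P \<and> (\<forall>y\<in>carrier L. D y = \<zero>\<^bsub>L\<^esub>)"
proof -
  have "\<exists>P D d. p_polynomial x P D \<and> monic x d P \<and> (\<forall>y\<in>Y. D y = \<zero>\<^bsub>L\<^esub>)"
    if "finite Y" "Y \<subseteq> carrier L" for Y
    using that
  proof (induction rule: finite_induct)
    case empty
    then show ?case using p_polynomial.self monic_act[OF x] by blast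
  next
    case (insert y Y)
    then obtain P D d where P: "p_polynomial x P D" "monic x d P" "\<forall>y\<in>Y. D y = \<zero>\<^bsub>L\<^esub>" by auto
    have y: "y \<in> carrier L" using insert.prems by simp
    have "\<exists>P' D' d'. p_polynomial x P' D' \<and> monic x d' P' \<and> D' y = \<zero>\<^bsub>L\<^esub>
      \<and> (\<forall>v\<in>carrier M. P v = \<zero> \<longrightarrow> P' v = \<zero>)
      \<and> (\<forall>y\<in>carrier L. D y = \<zero>\<^bsub>L\<^esub> \<longrightarrow> D' y = \<zero>\<^bsub>L\<^esub>)"
      by (rule p_polynomial_annihilate[where ev = "\<lambda>P D. D y", OF x P(1,2) L.vectorspace_axioms subset_refl finite_dimensional_algebra])
        (use y L.endomorphismD(1)[OF p_polynomial_endomorphism(2)[OF x]] in auto)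
    then obtain P' D' d' where P': "p_polynomial x P' D'" "monic x d' P'" "D' y = \<zero>\<^bsub>L\<^esub>"
      "\<forall>y\<in>carrier L. D y = \<zero>\<^bsub>L\<^esub> \<longrightarrow> D' y = \<zero>\<^bsub>L\<^esub>" by blast
    then have "\<forall>y\<in>insert y Y. D' y = \<zero>\<^bsub>L\<^esub>" using P(3) insert.prems by auto
    with P'(1,2) show ?case by blast
  qed
  from this[OF finite_B B_carrier] obtain P D d where
    P: "p_polynomial x P D" "monic x d P" "\<forall>y\<in>B. D y = \<zero>\<^bsub>L\<^esub>" by blast
  have "LinearCombinations.module.span K L B \<subseteq> {y \<in> carrier L. D y \<in> {\<zero>\<^bsub>L\<^esub>}}"
    by (rule L.span_least[OF subspace_vimage[OF _ _ p_polynomial_endomorphism(2)[OF x P(1)] L.subspace_zero]])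
      (use P(3) B_carrier L.vectorspace_axioms in auto)
  then show ?thesis using P(1,2) span_B by blast
qed

lemma central_p_polynomial_annihilating:
  assumes x: "x \<in> carrier L" and W: "lie_submodule K L W M" "finitely_spanned W"
  shows "\<exists>P d. monic x d P \<and> (\<exists>D. p_polynomial x P D) \<and> (\<forall>w\<in>W. P w = \<zero>)
    \<and> (\<forall>y\<in>carrier L. \<forall>v\<in>carrier M. P (act M y v) = act M y (P v))"
proof -
  have WV: "VectorSpace.subspace K W M" using W(1) by (simp add: lie_submodule_def)
  obtain A where A: "finite A" "A \<subseteq> W" "span A = W"
    using subspace_finite_spanning_subset[OF WV W(2)] by blast
  have "\<exists>P D d. p_polynomial x P D \<and> monic x d P \<and> (\<forall>y\<in>carrier L. D y = \<zero>\<^bsub>L\<^esub>) \<and> (\<forall>w\<in>A. P w = \<zero>)"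
    using A(1,2)
  proof (induction rule: finite_induct)
    case empty
    then show ?case using central_p_polynomial[OF x] by simp
  next
    case (insert w A)
    then obtain P D d where P: "p_polynomial x P D" "monic x d P" "\<forall>y\<in>carrier L. D y = \<zero>\<^bsub>L\<^esub>"
      "\<forall>w\<in>A. P w = \<zero>" by auto
    have w: "w \<in> W" "w \<in> carrier M" "A \<subseteq> carrier M" using insert.prems subspaceD(1)[OF WV] by auto
    have "\<exists>P' D' d'. p_polynomial x P' D' \<and> monic x d' P' \<and> P' w = \<zero>
      \<and> (\<forall>v\<in>carrier M. P v = \<zero> \<longrightarrow> P' v = \<zero>)
      \<and> (\<forall>y\<in>carrier L. D y = \<zero>\<^bsub>L\<^esub> \<longrightarrow> D' y = \<zero>\<^bsub>L\<^esub>)"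
      by (rule p_polynomial_annihilate[where ev = "\<lambda>P D. P w", OF x P(1,2) vectorspace_axioms _ W(2)])
        (use w subspaceD(1)[OF WV] p_polynomial_submodule[OF _ x W(1)] in auto)
    then obtain P' D' d' where P': "p_polynomial x P' D'" "monic x d' P'" "P' w = \<zero>"
      "\<forall>v\<in>carrier M. P v = \<zero> \<longrightarrow> P' v = \<zero>"
      "\<forall>y\<in>carrier L. D y = \<zero>\<^bsub>L\<^esub> \<longrightarrow> D' y = \<zero>\<^bsub>L\<^esub>" by blast
    have "\<forall>w\<in>insert w A. P' w = \<zero>" using P(4) P'(3,4) w(3) by auto
    moreover have "\<forall>y\<in>carrier L. D' y = \<zero>\<^bsub>L\<^esub>" using P(3) P'(5) by blast
    ultimately show ?case using P'(1,2) by blast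
  qed
  then obtain P D d where P: "p_polynomial x P D" "monic x d P" "\<forall>y\<in>carrier L. D y = \<zero>\<^bsub>L\<^esub>"
    "\<forall>w\<in>A. P w = \<zero>" by blast
  have PE: "P \<in> endomorphisms" by (rule p_polynomial_endomorphism(1)[OF x P(1)])
  have "span A \<subseteq> {v \<in> carrier M. P v \<in> {\<zero>}}"
    by (rule span_least[OF subspace_vimage[OF _ _ PE subspace_zero]])
      (use P(4) A(2) subspaceD(1)[OF WV] vectorspace_axioms in auto)
  then have "\<forall>w\<in>W. P w = \<zero>" using A(3) by blast
  moreover have "P (act M y v) = act M y (P v)" if "y \<in> carrier L" "v \<in> carrier M" for y v
  proof -
    have "act M \<zero>\<^bsub>L\<^esub> v = \<zero>"
      using act_smult_left[of "\<zero>\<^bsub>K\<^esub>" "\<zero>\<^bsub>L\<^esub>" v] act_closed[of "\<zero>\<^bsub>L\<^esub>" v] that(2) by simp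
    then show ?thesis
      using p_polynomial_leibniz[OF prime_characteristic x P(1) that] P(3) that
        endomorphismD(1)[OF PE] act_closed by simp
  qed
  ultimately show ?thesis using P(1,2) by blast
qed

end

section \<open>Essential extensions of locally finite modules\<close>

context vectorspace
begin

lemma noetherian_under_subset: "\<lbrakk>noetherian_under T N; N' \<subseteq> N\<rbrakk> \<Longrightarrow> noetherian_under T N'"
  unfolding noetherian_under_def by (meson subset_trans)

lemma noetherian_maximal:
  assumes noeth: "noetherian_under T N"
    and C: "C \<noteq> {}" "\<And>X. X \<in> C \<Longrightarrow> invariant_subspace T X \<and> X \<subseteq> N"
  shows "\<exists>X\<in>C. \<forall>Y\<in>C. X \<subseteq> Y \<longrightarrow> Y = X"
proof (rule ccontr)
  assume "\<not> ?thesis"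
  then obtain f where f: "\<And>X. X \<in> C \<Longrightarrow> f X \<in> C \<and> X \<subset> f X" by (metis psubsetI)
  obtain X0 where X0: "X0 \<in> C" using C(1) by blast
  have X: "(f ^^ n) X0 \<in> C" for n by (induction n) (use X0 f in auto)
  have strict: "(f ^^ n) X0 \<subset> (f ^^ Suc n) X0" for n using f[OF X[of n]] by simp
  have "\<exists>n. \<forall>k\<ge>n. (f ^^ k) X0 = (f ^^ n) X0"
    by (rule noetherian_underD[OF noeth]) (use C(2) X strict in blast)+
  then show False using strict by (metis le_SucI order_refl psubset_eq)
qed

end

context lie_module
begin

lemma lie_submodule_zero: "lie_submodule K L {\<zero>} M"
  using subspace_zero act_zero by (simp add: lie_submodule_def)

lemma lie_submodule_inter:
  "\<lbrakk>lie_submodule K L N M; lie_submodule K L N' M\<rbrakk> \<Longrightarrow> lie_submodule K L (N \<inter> N') M"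
  using subspace_inter by (simp add: lie_submodule_def)

lemma lie_submodule_sum:
  assumes N: "lie_submodule K L N M" and N': "lie_submodule K L N' M"
  shows "lie_submodule K L {u \<oplus> v | u v. u \<in> N \<and> v \<in> N'} M"
proof -
  have NV: "VectorSpace.subspace K N M" and NV': "VectorSpace.subspace K N' M"
    using N N' by (auto simp: lie_submodule_def)
  note ND = subspaceD[OF NV] and ND' = subspaceD[OF NV']
  have "{u \<oplus> v | u v. u \<in> N \<and> v \<in> N'} = submodule_sum N N'"
    by (auto simp: submodule_sum_def)
  then have "VectorSpace.subspace K {u \<oplus> v | u v. u \<in> N \<and> v \<in> N'} M"
    using sum_is_subspace[OF NV NV'] by simp
  moreover have "act M x w \<in> {u \<oplus> v | u v. u \<in> N \<and> v \<in> N'}"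
    if x: "x \<in> carrier L" and w: "w \<in> {u \<oplus> v | u v. u \<in> N \<and> v \<in> N'}" for x w
  proof -
    from w obtain u v where *: "w = u \<oplus> v" "u \<in> N" "v \<in> N'" by blast
    then have "act M x w = act M x u \<oplus> act M x v"
      using x ND(1) ND'(1) act_add_right by simp
    moreover have "act M x u \<in> N" "act M x v \<in> N'"
      using N N' x * by (auto simp: lie_submodule_def)
    ultimately show ?thesis by blast
  qed
  ultimately show ?thesis by (simp add: lie_submodule_def)
qed

lemma lie_generated_submodule:
  assumes "S \<subseteq> carrier M"
  shows "lie_submodule K L (lie_generated K L M S) M" "S \<subseteq> lie_generated K L M S"
proof -
  let ?C = "{N. lie_submodule K L N M \<and> S \<subseteq> N}"
  have "lie_submodule K L (carrier M) M"
    using subspace_carrier act_closed by (simp add: lie_submodule_def)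
  then have c: "carrier M \<in> ?C" using assms by simp
  have sub: "VectorSpace.subspace K N M" if "N \<in> ?C" for N using that by (simp add: lie_submodule_def)
  have "VectorSpace.subspace K (\<Inter>?C) M"
  proof (rule subspaceI)
    show "\<Inter>?C \<subseteq> carrier M" using c by blast
    show "\<zero> \<in> \<Inter>?C" using subspaceD(2)[OF sub] by blast
    show "u \<oplus> v \<in> \<Inter>?C" if "u \<in> \<Inter>?C" "v \<in> \<Inter>?C" for u v
      using that subspaceD(3)[OF sub] by blast
    show "k \<odot> v \<in> \<Inter>?C" if "k \<in> carrier K" "v \<in> \<Inter>?C" for k v
      using that subspaceD(4)[OF sub] by blast
  qed
  then show "lie_submodule K L (lie_generated K L M S) M"
    unfolding lie_generated_def lie_submodule_def by (auto simp: lie_submodule_def)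
  show "S \<subseteq> lie_generated K L M S" by (auto simp: lie_generated_def)
qed

lemma lie_submodule_kernel:
  assumes N: "lie_submodule K L N M" and f: "f \<in> endomorphisms"
    and comm: "\<And>x v. \<lbrakk>x \<in> carrier L; v \<in> carrier M\<rbrakk> \<Longrightarrow> f (act M x v) = act M x (f v)"
  shows "lie_submodule K L {v \<in> N. f v = \<zero>} M"
proof -
  have NV: "VectorSpace.subspace K N M" using N by (simp add: lie_submodule_def)
  have "{v \<in> N. f v = \<zero>} = N \<inter> {v \<in> carrier M. f v \<in> {\<zero>}}" using subspaceD(1)[OF NV] by auto
  moreover have "VectorSpace.subspace K {v \<in> carrier M. f v \<in> {\<zero>}} M"
    by (rule subspace_vimage[OF _ _ f subspace_zero]) unfold_locales
  ultimately have "VectorSpace.subspace K {v \<in> N. f v = \<zero>} M" using subspace_inter[OF NV] by simp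
  moreover have "act M x v \<in> {v \<in> N. f v = \<zero>}" if "x \<in> carrier L" "v \<in> {v \<in> N. f v = \<zero>}" for x v
    using that N comm[of x v] subspaceD(1)[OF NV] act_zero by (auto simp: lie_submodule_def)
  ultimately show ?thesis by (simp add: lie_submodule_def)
qed

lemma lie_submodule_image:
  assumes N: "lie_submodule K L N M" and f: "f \<in> endomorphisms"
    and comm: "\<And>x v. \<lbrakk>x \<in> carrier L; v \<in> carrier M\<rbrakk> \<Longrightarrow> f (act M x v) = act M x (f v)"
  shows "lie_submodule K L (f ` N) M"
proof -
  have NV: "VectorSpace.subspace K N M" using N by (simp add: lie_submodule_def)
  have "VectorSpace.subspace K (f ` N) M"
    by (rule subspace_image[OF _ _ f NV]) unfold_locales
  moreover have "act M x w \<in> f ` N" if x: "x \<in> carrier L" and w: "w \<in> f ` N" for x w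
  proof -
    from w obtain v where v: "v \<in> N" "w = f v" by blast
    then have "act M x w = f (act M x v)" using comm[OF x] subspaceD(1)[OF NV] by simp
    moreover have "act M x v \<in> N" using N x v(1) by (auto simp: lie_submodule_def)
    ultimately show ?thesis by blast
  qed
  ultimately show ?thesis by (simp add: lie_submodule_def)
qed

text \<open>
  Fitting's lemma.  If the kernels of the powers of \<open>z\<close> on \<open>V\<close> are stationary from \<open>m\<close> on, then the image
  of \<open>z\<^sup>m\<close> meets the kernel of \<open>z\<close> only in zero.  As \<open>V \<inter> N\<close> is contained in that kernel, the image meets
  the essential submodule \<open>N\<close> only in zero and therefore vanishes.
\<close>

lemma essential_nilpotent:
  assumes noeth: "noetherian_under T V" and T: "\<And>X. lie_submodule K L X M \<Longrightarrow> invariant_subspace T X"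
    and V: "lie_submodule K L V M" and N: "essential_submodule K L N M"
    and z: "z \<in> endomorphisms" and zV: "\<And>v. v \<in> V \<Longrightarrow> z v \<in> V"
    and comm: "\<And>x v. \<lbrakk>x \<in> carrier L; v \<in> carrier M\<rbrakk> \<Longrightarrow> z (act M x v) = act M x (z v)"
    and ann: "\<And>w. w \<in> V \<inter> N \<Longrightarrow> z w = \<zero>"
  shows "\<exists>m. \<forall>v\<in>V. (z ^^ m) v = \<zero>"
proof -
  note zn = endomorphism_funpow[OF z]
  have VV: "VectorSpace.subspace K V M" using V by (simp add: lie_submodule_def)
  have comm_n: "(z ^^ n) (act M x v) = act M x ((z ^^ n) v)"
    if "x \<in> carrier L" "v \<in> carrier M" for n x v
    using funpow_commute[of z "act M x" v n] endomorphismD(1)[OF z] act_closed comm that by simp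
  let ?X = "\<lambda>n. {v \<in> V. (z ^^ n) v = \<zero>}"
  have lie: "lie_submodule K L (?X n) M" for n by (rule lie_submodule_kernel[OF V zn comm_n])
  have "\<exists>m. \<forall>k\<ge>m. ?X k = ?X m"
    by (rule noetherian_underD[OF noeth T[OF lie]]) (auto simp: endomorphism_zero[OF z])
  then obtain m where m: "?X (Suc m) = ?X m" by (meson le_SucI order_refl)
  have img: "lie_submodule K L ((z ^^ m) ` V) M" by (rule lie_submodule_image[OF V zn comm_n])
  have "(z ^^ m) ` V \<inter> N \<subseteq> {\<zero>}"
  proof
    fix w assume w: "w \<in> (z ^^ m) ` V \<inter> N"
    then obtain v where v: "v \<in> V" "w = (z ^^ m) v" by blast
    have "(z ^^ n) v \<in> V" for n by (induction n) (use v(1) zV in auto)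
    then have "w \<in> V \<inter> N" using w v(2) by simp
    then have "z w = \<zero>" by (rule ann)
    then have "v \<in> ?X (Suc m)" using v by simp
    then have "v \<in> ?X m" unfolding m .
    then show "w \<in> {\<zero>}" using v by simp
  qed
  moreover have "\<zero> \<in> (z ^^ m) ` V \<inter> N"
    using img N subspaceD(2) by (auto simp: essential_submodule_def lie_submodule_def)
  ultimately have "(z ^^ m) ` V \<inter> N = {\<zero>}" by blast
  then have "(z ^^ m) ` V = {\<zero>}" using N img by (auto simp: essential_submodule_def)
  then show ?thesis by blast
qed

end

context filtered_lie_module
begin

lemma central_family:
  assumes W: "lie_submodule K L W M" "finitely_spanned W"
  shows "\<exists>P d. (\<forall>b\<in>B. monic b (d b) (P b) \<and> P b \<in> endomorphisms \<and> (\<forall>w\<in>W. P b w = \<zero>)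
        \<and> (\<forall>x\<in>carrier L. \<forall>v\<in>carrier M. P b (act M x v) = act M x (P b v)))
      \<and> (\<forall>f\<in>P ` B. \<forall>g\<in>P ` B. \<forall>v\<in>carrier M. f (g v) = g (f v))
      \<and> (\<forall>X. lie_submodule K L X M \<longrightarrow> invariant_subspace (P ` B) X)"
proof -
  have "\<forall>b\<in>B. \<exists>q. monic b (snd q) (fst q) \<and> (\<exists>D. p_polynomial b (fst q) D) \<and> (\<forall>w\<in>W. fst q w = \<zero>)
    \<and> (\<forall>y\<in>carrier L. \<forall>v\<in>carrier M. fst q (act M y v) = act M y (fst q v))"
  proof
    fix b assume "b \<in> B"
    then have "b \<in> carrier L" using B_carrier by blast
    from central_p_polynomial_annihilating[OF this W] obtain P d where
      "monic b d P \<and> (\<exists>D. p_polynomial b P D) \<and> (\<forall>w\<in>W. P w = \<zero>)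
        \<and> (\<forall>y\<in>carrier L. \<forall>v\<in>carrier M. P (act M y v) = act M y (P v))" by blast
    then show "\<exists>q. monic b (snd q) (fst q) \<and> (\<exists>D. p_polynomial b (fst q) D) \<and> (\<forall>w\<in>W. fst q w = \<zero>)
        \<and> (\<forall>y\<in>carrier L. \<forall>v\<in>carrier M. fst q (act M y v) = act M y (fst q v))"
      by (intro exI[of _ "(P, d)"]) simp
  qed
  from bchoice[OF this] obtain q where q: "\<And>b. b \<in> B \<Longrightarrow> monic b (snd (q b)) (fst (q b))
    \<and> (\<exists>D. p_polynomial b (fst (q b)) D) \<and> (\<forall>w\<in>W. fst (q b) w = \<zero>)
    \<and> (\<forall>y\<in>carrier L. \<forall>v\<in>carrier M. fst (q b) (act M y v) = act M y (fst (q b) v))"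
    by blast
  define P where "P b = fst (q b)" for b
  have BL: "b \<in> carrier L" if "b \<in> B" for b using that B_carrier by blast
  have poly: "\<exists>D. p_polynomial b (P b) D" if "b \<in> B" for b using q[OF that] by (simp add: P_def)
  have E: "P b \<in> endomorphisms" if "b \<in> B" for b
    using poly[OF that] p_polynomial_endomorphism(1)[OF BL[OF that]] by blast
  have comm: "P b (act M x v) = act M x (P b v)" if "b \<in> B" "x \<in> carrier L" "v \<in> carrier M" for b x v
    using q[OF that(1)] that(2,3) by (simp add: P_def)
  have "f (g v) = g (f v)" if "f \<in> P ` B" "g \<in> P ` B" "v \<in> carrier M" for f g v
  proof -
    from that obtain b c where bc: "b \<in> B" "c \<in> B" "f = P b" "g = P c" by blast
    obtain D where "p_polynomial c (P c) D" using poly[OF bc(2)] by blast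
    then show ?thesis
      unfolding bc(3,4)
      by (rule p_polynomial_commute[OF BL[OF bc(2)] _ E[OF bc(1)] comm[OF bc(1) BL[OF bc(2)]] that(3)])
  qed
  moreover have "invariant_subspace (P ` B) X" if X: "lie_submodule K L X M" for X
    unfolding invariant_subspace_def
  proof (intro conjI ballI)
    show "VectorSpace.subspace K X M" using X by (simp add: lie_submodule_def)
    show "f v \<in> X" if f: "f \<in> P ` B" and v: "v \<in> X" for f v
    proof -
      from f obtain b where b: "b \<in> B" "f = P b" by blast
      then obtain D where "p_polynomial b f D" using poly by blast
      then show ?thesis using p_polynomial_submodule[OF _ BL[OF b(1)] X v] by blast
    qed
  qed
  moreover have "monic b (snd (q b)) (P b) \<and> P b \<in> endomorphisms \<and> (\<forall>w\<in>W. P b w = \<zero>)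
      \<and> (\<forall>x\<in>carrier L. \<forall>v\<in>carrier M. P b (act M x v) = act M x (P b v))" if "b \<in> B" for b
    using q[OF that] E[OF that] comm[OF that] by (simp add: P_def)
  ultimately show ?thesis by (intro exI[of _ P] exI[of _ "\<lambda>b. snd (q b)"]) blast
qed

lemma generated_noetherian:
  "\<exists>T. noetherian_under T (\<Union>m. filtration m)
    \<and> (\<forall>X. lie_submodule K L X M \<longrightarrow> invariant_subspace T X)"
proof -
  have "finitely_spanned {\<zero>}"
    using in_own_span[of "{\<zero>}"] unfolding finitely_spanned_def by (intro exI[of _ "{\<zero>}"]) auto
  from central_family[OF lie_submodule_zero this] obtain P d where
    *: "(\<forall>b\<in>B. monic b (d b) (P b) \<and> P b \<in> endomorphisms \<and> (\<forall>w\<in>{\<zero>}. P b w = \<zero>)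
        \<and> (\<forall>x\<in>carrier L. \<forall>v\<in>carrier M. P b (act M x v) = act M x (P b v)))
      \<and> (\<forall>f\<in>P ` B. \<forall>g\<in>P ` B. \<forall>v\<in>carrier M. f (g v) = g (f v))
      \<and> (\<forall>X. lie_submodule K L X M \<longrightarrow> invariant_subspace (P ` B) X)"
    by (elim exE)
  have P: "\<And>b. b \<in> B \<Longrightarrow> monic b (d b) (P b)" "P ` B \<subseteq> endomorphisms"
      "\<And>f g v. \<lbrakk>f \<in> P ` B; g \<in> P ` B; v \<in> carrier M\<rbrakk> \<Longrightarrow> f (g v) = g (f v)"
      "\<And>X. lie_submodule K L X M \<Longrightarrow> invariant_subspace (P ` B) X"
    using * by simp_all (auto simp: image_iff)
  have "finite (P ` B)" using finite_B by simp
  then have "\<exists>H. invariant_subspace (P ` B) H \<and> filtration (Suc (sum d B)) \<subseteq> H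
      \<and> noetherian_under (P ` B) H"
    by (rule invariant_hull_noetherian[OF _ P(2) _ filtration_subspace filtration_finitely_spanned])
      (rule P(3))
  then obtain H where H: "invariant_subspace (P ` B) H" "filtration (Suc (sum d B)) \<subseteq> H"
    "noetherian_under (P ` B) H" by blast
  have "(\<Union>m. filtration m) \<subseteq> H" using filtration_generated[OF P(1) H(1,2)] by blast
  then show ?thesis using noetherian_under_subset[OF H(3)] P(4) by blast
qed

text \<open>
  Among the finite-dimensional submodules of the intersection there is a maximal one, by the chain
  condition; since every element lies in a finite-dimensional submodule and sums of such are
  finite-dimensional, it is the whole intersection.
\<close>

lemma generated_locally_finite_inter:
  assumes N: "lie_submodule K L N M"
    and lf: "\<And>w. w \<in> N \<Longrightarrow> \<exists>G. lie_submodule K L G M \<and> w \<in> G \<and> G \<subseteq> N \<and> finitely_spanned G"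
  shows "finitely_spanned ((\<Union>m. filtration m) \<inter> N)"
proof -
  let ?V = "\<Union>m. filtration m"
  obtain T where T: "noetherian_under T ?V" "\<And>X. lie_submodule K L X M \<Longrightarrow> invariant_subspace T X"
    using generated_noetherian by blast
  let ?C = "{X. lie_submodule K L X M \<and> X \<subseteq> ?V \<inter> N \<and> finitely_spanned X}"
  have "{\<zero>} \<in> ?C"
    using lie_submodule_zero filtration_Union_submodule N subspaceD(2) filtrationD(2)
      finitely_spanned_subset[OF filtration_finitely_spanned, of "{\<zero>}" 0]
    by (auto simp: lie_submodule_def)
  then have "\<exists>X\<in>?C. \<forall>Y\<in>?C. X \<subseteq> Y \<longrightarrow> Y = X"
    by (intro noetherian_maximal[OF T(1)]) (use T(2) in blast)+
  then obtain X where X: "X \<in> ?C" and max': "\<forall>Y\<in>?C. X \<subseteq> Y \<longrightarrow> Y = X" ..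
  have max: "Y = X" if "Y \<in> ?C" "X \<subseteq> Y" for Y using bspec[OF max' that(1)] that(2) by (rule mp)
  have XV: "VectorSpace.subspace K X M" using X by (simp add: lie_submodule_def)
  have VN: "VectorSpace.subspace K (?V \<inter> N) M"
    using lie_submodule_inter[OF filtration_Union_submodule N] by (simp add: lie_submodule_def)
  have "w \<in> X" if w: "w \<in> ?V \<inter> N" for w
  proof -
    obtain G where G: "lie_submodule K L G M" "w \<in> G" "G \<subseteq> N" "finitely_spanned G"
      using lf w by blast
    let ?G = "G \<inter> ?V" and ?Y = "{u \<oplus> v | u v. u \<in> X \<and> v \<in> G \<inter> ?V}"
    have G': "lie_submodule K L ?G M" by (rule lie_submodule_inter[OF G(1) filtration_Union_submodule])
    then have GV: "VectorSpace.subspace K ?G M" by (simp add: lie_submodule_def)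
    have "lie_submodule K L ?Y M" using lie_submodule_sum[OF _ G'] X by blast
    moreover have "?Y \<subseteq> ?V \<inter> N" using X G(3) subspaceD(3)[OF VN] by blast
    moreover have "finitely_spanned ?Y"
      using X finitely_spanned_sum finitely_spanned_subset[OF G(4), of ?G] by blast
    ultimately have "?Y \<in> ?C" by blast
    moreover have "X \<subseteq> ?Y"
    proof
      fix u assume u: "u \<in> X"
      have "u = u \<oplus> \<zero>" using subspaceD(1)[OF XV u] by simp
      then show "u \<in> ?Y" using u subspaceD(2)[OF GV] by blast
    qed
    ultimately have "?Y = X" by (rule max)
    moreover have "w = \<zero> \<oplus> w" using subspaceD(1)[OF VN w] by simp
    then have "w \<in> ?Y" using subspaceD(2)[OF XV] w G(2) by blast
    ultimately show ?thesis by blast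
  qed
  then have "?V \<inter> N \<subseteq> X" by blast
  then show ?thesis using finitely_spanned_subset X by blast
qed

text \<open>
  The central operators are chosen a second time, now so that they annihilate the intersection with
  \<open>N\<close>, which is already known to be finite-dimensional.  They are then nilpotent on the whole generated
  module, and a module that is finitely generated over commuting nilpotent operators has finite
  dimension.
\<close>

lemma generated_finitely_spanned:
  assumes N: "essential_submodule K L N M"
    and lf: "\<And>w. w \<in> N \<Longrightarrow> \<exists>G. lie_submodule K L G M \<and> w \<in> G \<and> G \<subseteq> N \<and> finitely_spanned G"
  shows "finitely_spanned (\<Union>m. filtration m)"
proof -
  let ?V = "\<Union>m. filtration m"
  note V = filtration_Union_submodule
  have NL: "lie_submodule K L N M" using N by (simp add: essential_submodule_def)
  obtain T where T: "noetherian_under T ?V" "\<And>X. lie_submodule K L X M \<Longrightarrow> invariant_subspace T X"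
    using generated_noetherian by blast
  have "finitely_spanned (?V \<inter> N)" by (rule generated_locally_finite_inter[OF NL lf])
  from central_family[OF lie_submodule_inter[OF V NL] this]
  obtain P d where
    *: "(\<forall>b\<in>B. monic b (d b) (P b) \<and> P b \<in> endomorphisms \<and> (\<forall>w\<in>?V \<inter> N. P b w = \<zero>)
        \<and> (\<forall>x\<in>carrier L. \<forall>v\<in>carrier M. P b (act M x v) = act M x (P b v)))
      \<and> (\<forall>f\<in>P ` B. \<forall>g\<in>P ` B. \<forall>v\<in>carrier M. f (g v) = g (f v))
      \<and> (\<forall>X. lie_submodule K L X M \<longrightarrow> invariant_subspace (P ` B) X)"
    by (elim exE)
  have P: "\<And>b. b \<in> B \<Longrightarrow> monic b (d b) (P b)" "\<And>b w. \<lbrakk>b \<in> B; w \<in> ?V \<inter> N\<rbrakk> \<Longrightarrow> P b w = \<zero>"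
      "P ` B \<subseteq> endomorphisms"
      "\<And>b x v. \<lbrakk>b \<in> B; x \<in> carrier L; v \<in> carrier M\<rbrakk> \<Longrightarrow> P b (act M x v) = act M x (P b v)"
      "\<And>f g v. \<lbrakk>f \<in> P ` B; g \<in> P ` B; v \<in> carrier M\<rbrakk> \<Longrightarrow> f (g v) = g (f v)"
      "\<And>X. lie_submodule K L X M \<Longrightarrow> invariant_subspace (P ` B) X"
    using * by simp_all (auto simp: image_iff)
  have nil: "\<exists>m. \<forall>v\<in>?V. (f ^^ m) v = \<zero>" if "f \<in> P ` B" for f
  proof -
    from that obtain b where b: "b \<in> B" "f = P b" by blast
    have f: "f \<in> endomorphisms" "\<And>v. v \<in> ?V \<Longrightarrow> f v \<in> ?V"
      using that P(3) P(6)[OF V] unfolding invariant_subspace_def by blast+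
    show ?thesis
      by (rule essential_nilpotent[OF T V N f]) (use b P(2,4) in auto)
  qed
  have "finite (P ` B)" using finite_B by simp
  then have "\<exists>H. invariant_subspace (P ` B) H \<and> filtration (Suc (sum d B)) \<subseteq> H
      \<and> H \<subseteq> ?V \<and> finitely_spanned H"
    by (rule invariant_hull_nilpotent[OF _ P(3) _ filtration_subspace filtration_finitely_spanned _
        P(6)[OF V] nil]) (use P(5) in blast)+
  then obtain H where H: "invariant_subspace (P ` B) H" "filtration (Suc (sum d B)) \<subseteq> H"
    "finitely_spanned H" by blast
  have "?V \<subseteq> H" using filtration_generated[OF P(1) H(1,2)] by blast
  then show ?thesis using finitely_spanned_subset[OF H(3)] by blast
qed

end

lemma lie_hom_image_submodule:
  assumes M: "lie_module K L M" and E: "lie_module K L E" and f: "f \<in> lie_hom K L M E"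
    and N: "lie_submodule K L N M"
  shows "lie_submodule K L (f ` N) E"
proof -
  interpret M: lie_module K L M by (fact M)
  interpret E: lie_module K L E by (fact E)
  have NV: "VectorSpace.subspace K N M" using N by (simp add: lie_submodule_def)
  have fV: "f \<in> LinearCombinations.module_hom K M E" using f by (simp add: lie_hom_def)
  have "VectorSpace.subspace K (f ` N) E"
    by (rule subspace_image[OF M.vectorspace_axioms E.vectorspace_axioms fV NV])
  moreover have "act E x w \<in> f ` N" if x: "x \<in> carrier L" and w: "w \<in> f ` N" for x w
  proof -
    from w obtain v where v: "v \<in> N" "w = f v" by blast
    then have "act E x w = f (act M x v)" using lie_homD(4)[OF f x] M.subspaceD(1)[OF NV] by simp
    moreover have "act M x v \<in> N" using N x v(1) by (auto simp: lie_submodule_def)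
    ultimately show ?thesis by blast
  qed
  ultimately show ?thesis by (simp add: lie_submodule_def)
qed

theorem locally_finite_essential_extension:
  assumes p: "Factorial_Ring.prime (characteristic K)" and L: "vectorspace.fin_dim K L"
    and M: "lie_module K L M" "locally_finite K L M" and E: "lie_module K L E"
    and f: "f \<in> lie_hom K L M E" and ess: "essential_submodule K L (f ` carrier M) E"
  shows "locally_finite K L E"
  unfolding locally_finite_def
proof (intro allI impI)
  interpret M: lie_module K L M by (fact M(1))
  interpret E: lie_module K L E by (fact E)
  fix S assume S: "finite S \<and> S \<subseteq> carrier E"
  obtain B where B: "finite B" "B \<subseteq> carrier L" "LinearCombinations.module.span K L B = carrier L"
    using L vectorspace.fin_dim_def[OF M.L.vectorspace_axioms] by auto
  interpret F: filtered_lie_module K L E B S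
    by (intro filtered_lie_module.intro filtered_lie_module_axioms.intro) (use E p B S in auto)
  have fV: "f \<in> LinearCombinations.module_hom K M E" using f by (simp add: lie_hom_def)
  have "E.finitely_spanned (\<Union>m. F.filtration m)"
  proof (rule F.generated_finitely_spanned[OF ess])
    fix w assume "w \<in> f ` carrier M"
    then obtain m where m: "m \<in> carrier M" "w = f m" by blast
    let ?G = "lie_generated K L M {m}"
    have G: "lie_submodule K L ?G M" "m \<in> ?G" using M.lie_generated_submodule[of "{m}"] m(1) by auto
    have GV: "VectorSpace.subspace K ?G M" using G(1) by (simp add: lie_submodule_def)
    have "vectorspace.fin_dim K (M\<lparr>carrier := ?G\<rparr>)" using M(2) m(1) by (simp add: locally_finite_def)
    then have "E.finitely_spanned (f ` ?G)"
      using finitely_spanned_image[OF M.vectorspace_axioms E.vectorspace_axioms fV] M.fin_dim_vs_iff[OF GV]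
      by blast
    moreover have "f ` ?G \<subseteq> f ` carrier M" using M.subspaceD(1)[OF GV] by blast
    ultimately show "\<exists>G. lie_submodule K L G E \<and> w \<in> G \<and> G \<subseteq> f ` carrier M \<and> E.finitely_spanned G"
      using lie_hom_image_submodule[OF M(1) E f G(1)] G(2) m(2) by blast
  qed
  moreover have "lie_generated K L E S \<subseteq> (\<Union>m. F.filtration m)"
    using F.filtration_Union_submodule F.S_in_filtration by (auto simp: lie_generated_def)
  ultimately have "E.finitely_spanned (lie_generated K L E S)" using E.finitely_spanned_subset by blast
  moreover have "VectorSpace.subspace K (lie_generated K L E S) E"
    using E.lie_generated_submodule(1) S by (simp add: lie_submodule_def)
  ultimately show "vectorspace.fin_dim K (E\<lparr>carrier := lie_generated K L E S\<rparr>)"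
    using E.fin_dim_vs_iff by blast
qed

theorem corollary2p2:
  fixes K :: "('k, 'r) ring_scheme"
    and L :: "('k, 'a) lie_algebra"
    and M :: "('k, 'a, 'm) lie_module"
    and E :: "('k, 'a, 'e) lie_module"
    and \<iota> :: "'m \<Rightarrow> 'e"
  assumes "field K" and "Factorial_Ring.prime (characteristic K)"
    and "lie_algebra K L" and "vectorspace.fin_dim K L"
    and "lie_module K L M" and "locally_finite K L M"
    and "injective_hull K L M E \<iota>"
  shows "locally_finite K L E"
proof -
  have "lie_module K L E" "\<iota> \<in> lie_hom K L M E" "essential_submodule K L (\<iota> ` carrier M) E"
    using assms(7) by (auto simp: injective_hull_def lie_injective_def)
  with assms(2,4-6) show ?thesis by (rule locally_finite_essential_extension)
qed

end
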